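(* The varieties $\mathbf C_{mn}$, $m,n\in\mathbb N=\{1,2,\dots\}$, are strongly tolerance factorable and each of them has proper tolerances. Furthermore, for all $i,j,m,n\in\mathbb N$, $\mathbf C_{mn}$ is term equivalent to $\mathbf C_{ij}$ if and only if $(i,j)=(m,n)$.
   Context: Rotational lattices. A rotational lattice of order $m$ is an algebra $(L,\vee,\wedge,g_m)$ such that $(L,\vee,\wedge)$ is a lattice and $g_m$ is a unary operation that is an automorphism of the lattice $(L,\vee,\wedge)$ and satisfies the identity $g_m^m(x)=x$, where $g_m^m$ is the $m$-fold iterate of $g_m$. $\mathbf{RLat}_m$ is the variety of all these algebras. The varieties $\mathcal S^{(n)}$. For $2\le n\in\mathbb N$ and $1\le i\le n$, let $\mathcal S^{(n)}_i$ be the variety of type $\{f_n\}$, with $f_n$ an $n$-ary operation symbol, defined by the identity $f_n(x_1,\dots,x_n)=x_i$ (so its members are all nonempty sets $X$ with $f_n$ acting as the $i$-th projection). Let $\mathcal S^{(n)}=\mathcal S^{(n)}_1\vee\dots\vee\mathcal S^{(n)}_n$, the join in the lattice of all varieties of type $\{f_n\}$. Let $\mathcal S^{(1)}$ be the variety of sets (with no operations). The varieties $\mathbf C_{mn}$. Let $h$ be a binary operation symbol and, for $m,n\in\mathbb N$, let $\tau_{mn}=\{\vee,\wedge,g_m,f_n,h\}$ be the type with $\vee,\wedge,h$ binary, $g_m$ unary, $f_n$ $n$-ary. Let ${}^{n}(\mathbf{RLat}_m)$ be the variety of type $\tau_{mn}$ obtained from the algebras of $\mathbf{RLat}_m$ by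 letting $f_n$ and $h$ act as first projections. Let ${}(\mathcal S^{(n)})^{m}$ be the variety of type $\tau_{mn}$ obtained from the members of $\mathcal S^{(n)}$ by letting $\vee$, $\wedge$ and $g_m$ act as first projections and $h$ as the binary second projection (for $n=1$, $f_1$ acts as the unary identity map). Then $\mathbf C_{mn}={}^{n}(\mathbf{RLat}_m)\vee(\mathcal S^{(n)})^{m}$, the join in the lattice of all varieties of type $\tau_{mn}$. Tolerances and blocks. A tolerance on an algebra $\mathcal A=(A,F)$ is a reflexive, symmetric relation $T\subseteq A^2$ compatible with all operations in $F$; $\mathrm{Tol}(\mathcal A)$ is the set of all tolerances of $\mathcal A$. A tolerance is proper if it is not a congruence. A block of $T$ is a maximal subset $B\subseteq A$ such that $B^2\subseteq T$; $\mathrm{Block}(T)$ is the set of all blocks of $T$. For every $n$-ary $f\in F$ and $B_1,\dots,B_n\in\mathrm{Block}(T)$ there is at least one $B\in\mathrm{Block}(T)$ with $\{f(b_1,\dots,b_n): b_1\in B_1,\dots,b_n\in B_n\}\subseteq B$. The algebra $\mathcal A$ is $T$-factorable if, for each $n$, each $n$-ary $f\in F$ and all $B_1,\dots,B_n\in\mathrm{Block}(T)$, this block $B$ is uniquely determined; in this case $f(B_1,\dots,B_n):=B$ defines the quotient algebra $\mathcal A/T=(\mathrm{Block}(T),F)$. The algebra $\mathcal A$ is tolerance factorable if it is $T$-factorable for all $T\in\mathrm{Tol}(\mathcal A)$. Properties of a variety $\mathcal W$. $\mathcal W$ is tolerance factorable if all of its members are tolerance factorable. $\mathcal W$ is strongly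 tolerance factorable if it is tolerance factorable and $\mathcal A/T\in\mathcal W$ for all $\mathcal A\in\mathcal W$ and all $T\in\mathrm{Tol}(\mathcal A)$. $\mathcal W$ has proper tolerances if at least one of its members has a proper tolerance. "Equivalent" means term equivalent (also called rationally equivalent) in the usual sense for varieties of possibly different types; e.g. the variety of Boolean algebras is equivalent to that of Boolean rings. *)

theory Defs
  imports Main
begin

section \<open>Algebras, terms and varieties\<close>

text \<open>A type (signature) is a partial map from operation symbols to arities. An algebra
  interprets every symbol as a function on lists; only the values at symbols of the type, on
  argument lists of the right length over the carrier, are meaningful. In particular an algebra
  of a larger type is at the same time its own reduct to any smaller type.\<close>

type_synonym 'f signature = "'f \<Rightarrow> nat option"

record ('f, 'a) alg =
  carrier :: "'a set"
  opn :: "'f \<Rightarrow> 'a list \<Rightarrow> 'a"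

definition is_algebra :: "'f signature \<Rightarrow> ('f, 'a) alg \<Rightarrow> bool" where
  "is_algebra \<tau> A \<longleftrightarrow> carrier A \<noteq> {} \<and>
     (\<forall>f n xs. \<tau> f = Some n \<and> length xs = n \<and> set xs \<subseteq> carrier A \<longrightarrow> opn A f xs \<in> carrier A)"

datatype 'f trm = Var nat | App 'f "'f trm list"

fun wf_trm :: "'f signature \<Rightarrow> 'f trm \<Rightarrow> bool" where
  "wf_trm \<tau> (Var x) \<longleftrightarrow> True"
| "wf_trm \<tau> (App f ts) \<longleftrightarrow> \<tau> f = Some (length ts) \<and> (\<forall>t\<in>set ts. wf_trm \<tau> t)"

fun vars :: "'f trm \<Rightarrow> nat set" where
  "vars (Var x) = {x}"
| "vars (App f ts) = (\<Union>t\<in>set ts. vars t)"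

fun eval :: "('f, 'a) alg \<Rightarrow> (nat \<Rightarrow> 'a) \<Rightarrow> 'f trm \<Rightarrow> 'a" where
  "eval A \<sigma> (Var x) = \<sigma> x"
| "eval A \<sigma> (App f ts) = opn A f (map (eval A \<sigma>) ts)"

definition satisfies :: "('f, 'a) alg \<Rightarrow> 'f trm \<times> 'f trm \<Rightarrow> bool" where
  "satisfies A e \<longleftrightarrow>
     (\<forall>\<sigma>. range \<sigma> \<subseteq> carrier A \<longrightarrow> eval A \<sigma> (fst e) = eval A \<sigma> (snd e))"

definition Mod :: "'f signature \<Rightarrow> ('f trm \<times> 'f trm) set \<Rightarrow> ('f, 'a) alg set" where
  "Mod \<tau> E = {A. is_algebra \<tau> A \<and> (\<forall>e\<in>E. satisfies A e)}"

text \<open>A class of algebras is represented by the set of its members whose carriers are subsets of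
  a given HOL type \<open>'a\<close>. If \<open>'a\<close> is infinite and there are only countably many operation symbols,
  a variety is determined by this set: an identity that fails in some member fails in a countable
  one. So for infinite \<open>'a\<close> the ordered set of the varieties below is the usual lattice of all
  varieties of type \<open>\<tau>\<close>.\<close>

definition variety :: "'f signature \<Rightarrow> ('f, 'a) alg set \<Rightarrow> bool" where
  "variety \<tau> V \<longleftrightarrow> (\<exists>E. (\<forall>(s, t)\<in>E. wf_trm \<tau> s \<and> wf_trm \<tau> t) \<and> V = Mod \<tau> E)"

definition variety_join :: "'f signature \<Rightarrow> ('f, 'a) alg set set \<Rightarrow> ('f, 'a) alg set" where
  "variety_join \<tau> K = \<Inter>{V. variety \<tau> V \<and> (\<forall>U\<in>K. U \<subseteq> V)}"

lemma variety_join_lub: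
  assumes "\<And>U A. U \<in> K \<Longrightarrow> A \<in> U \<Longrightarrow> is_algebra \<tau> A"
  shows "variety \<tau> (variety_join \<tau> K)"
    and "U \<in> K \<Longrightarrow> U \<subseteq> variety_join \<tau> K"
    and "variety \<tau> V \<Longrightarrow> (\<And>U. U \<in> K \<Longrightarrow> U \<subseteq> V) \<Longrightarrow> variety_join \<tau> K \<subseteq> V"
proof -
  define D where "D = {E. (\<forall>(s, t)\<in>E. wf_trm \<tau> s \<and> wf_trm \<tau> t) \<and> (\<forall>U\<in>K. U \<subseteq> Mod \<tau> E)}"
  have "{} \<in> D" using assms by (auto simp: D_def Mod_def)
  then have "(\<Inter>E\<in>D. Mod \<tau> E) = Mod \<tau> (\<Union>D)"
    unfolding Mod_def by blast
  moreover have "variety_join \<tau> K = (\<Inter>E\<in>D. Mod \<tau> E)"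
    unfolding variety_join_def variety_def D_def by blast
  moreover have "\<forall>(s, t)\<in>\<Union>D. wf_trm \<tau> s \<and> wf_trm \<tau> t"
    unfolding D_def by blast
  ultimately show "variety \<tau> (variety_join \<tau> K)"
    unfolding variety_def by metis
  show "U \<in> K \<Longrightarrow> U \<subseteq> variety_join \<tau> K"
    unfolding variety_join_def by blast
  show "variety \<tau> V \<Longrightarrow> (\<And>U. U \<in> K \<Longrightarrow> U \<subseteq> V) \<Longrightarrow> variety_join \<tau> K \<subseteq> V"
    unfolding variety_join_def by blast
qed

section \<open>Tolerances\<close>

definition compatible :: "'f signature \<Rightarrow> ('f, 'a) alg \<Rightarrow> ('a \<times> 'a) set \<Rightarrow> bool" where
  "compatible \<tau> A T \<longleftrightarrow>
     (\<forall>f n xs ys. \<tau> f = Some n \<and> length xs = n \<and> length ys = n \<and>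
        list_all2 (\<lambda>x y. (x, y) \<in> T) xs ys \<longrightarrow> (opn A f xs, opn A f ys) \<in> T)"

definition tolerance :: "'f signature \<Rightarrow> ('f, 'a) alg \<Rightarrow> ('a \<times> 'a) set \<Rightarrow> bool" where
  "tolerance \<tau> A T \<longleftrightarrow>
     T \<subseteq> carrier A \<times> carrier A \<and> refl_on (carrier A) T \<and> sym T \<and> compatible \<tau> A T"

definition congruence :: "'f signature \<Rightarrow> ('f, 'a) alg \<Rightarrow> ('a \<times> 'a) set \<Rightarrow> bool" where
  "congruence \<tau> A T \<longleftrightarrow> equiv (carrier A) T \<and> compatible \<tau> A T"

definition proper_tolerance :: "'f signature \<Rightarrow> ('f, 'a) alg \<Rightarrow> ('a \<times> 'a) set \<Rightarrow> bool" where
  "proper_tolerance \<tau> A T \<longleftrightarrow> tolerance \<tau> A T \<and> \<not> congruence \<tau> A T"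

definition Block :: "('f, 'a) alg \<Rightarrow> ('a \<times> 'a) set \<Rightarrow> 'a set set" where
  "Block A T = {B. B \<subseteq> carrier A \<and> B \<times> B \<subseteq> T \<and>
     (\<forall>B'. B' \<subseteq> carrier A \<and> B' \<times> B' \<subseteq> T \<and> B \<subseteq> B' \<longrightarrow> B' = B)}"

definition set_op :: "('f, 'a) alg \<Rightarrow> 'f \<Rightarrow> 'a set list \<Rightarrow> 'a set" where
  "set_op A f Bs = {opn A f bs | bs. list_all2 (\<lambda>b B. b \<in> B) bs Bs}"

definition factorable :: "'f signature \<Rightarrow> ('f, 'a) alg \<Rightarrow> ('a \<times> 'a) set \<Rightarrow> bool" where
  "factorable \<tau> A T \<longleftrightarrow>
     (\<forall>f n Bs. \<tau> f = Some n \<and> length Bs = n \<and> set Bs \<subseteq> Block A T \<longrightarrow>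
        (\<exists>!B. B \<in> Block A T \<and> set_op A f Bs \<subseteq> B))"

definition quotient_alg :: "('f, 'a) alg \<Rightarrow> ('a \<times> 'a) set \<Rightarrow> ('f, 'a set) alg" where
  "quotient_alg A T = \<lparr>carrier = Block A T,
     opn = (\<lambda>f Bs. THE B. B \<in> Block A T \<and> set_op A f Bs \<subseteq> B)\<rparr>"

definition tolerance_factorable_alg :: "'f signature \<Rightarrow> ('f, 'a) alg \<Rightarrow> bool" where
  "tolerance_factorable_alg \<tau> A \<longleftrightarrow> (\<forall>T. tolerance \<tau> A T \<longrightarrow> factorable \<tau> A T)"

definition tolerance_factorable :: "'f signature \<Rightarrow> ('f, 'a) alg set \<Rightarrow> bool" where
  "tolerance_factorable \<tau> W \<longleftrightarrow> (\<forall>A\<in>W. tolerance_factorable_alg \<tau> A)"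

text \<open>The carrier of a quotient consists of sets of elements, so the variety is passed twice:
  \<open>W\<close> are its members over \<open>'a\<close>, and \<open>W'\<close> its members over \<open>'a set\<close>.\<close>

definition strongly_tolerance_factorable ::
  "'f signature \<Rightarrow> ('f, 'a) alg set \<Rightarrow> ('f, 'a set) alg set \<Rightarrow> bool" where
  "strongly_tolerance_factorable \<tau> W W' \<longleftrightarrow> tolerance_factorable \<tau> W \<and>
     (\<forall>A\<in>W. \<forall>T. tolerance \<tau> A T \<longrightarrow> quotient_alg A T \<in> W')"

definition has_proper_tolerances :: "'f signature \<Rightarrow> ('f, 'a) alg set \<Rightarrow> bool" where
  "has_proper_tolerances \<tau> W \<longleftrightarrow> (\<exists>A\<in>W. \<exists>T. proper_tolerance \<tau> A T)"

section \<open>Term equivalence\<close>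

text \<open>A translation assigns to every \<open>n\<close>-ary symbol of \<open>\<tau>\<close> a term of type \<open>\<tau>'\<close> in the variables
  \<open>0, \<dots>, n - 1\<close>. It turns algebras of type \<open>\<tau>'\<close> into algebras of type \<open>\<tau>\<close> on the same carrier.\<close>

definition translation :: "'f signature \<Rightarrow> 'g signature \<Rightarrow> ('f \<Rightarrow> 'g trm) \<Rightarrow> bool" where
  "translation \<tau> \<tau>' p \<longleftrightarrow>
     (\<forall>f n. \<tau> f = Some n \<longrightarrow> wf_trm \<tau>' (p f) \<and> vars (p f) \<subseteq> {..<n})"

definition derived_alg :: "('f \<Rightarrow> 'g trm) \<Rightarrow> ('g, 'a) alg \<Rightarrow> ('f, 'a) alg" where
  "derived_alg p A = \<lparr>carrier = carrier A, opn = (\<lambda>f xs. eval A (\<lambda>i. xs ! i) (p f))\<rparr>"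

definition same_alg :: "'f signature \<Rightarrow> ('f, 'a) alg \<Rightarrow> ('f, 'a) alg \<Rightarrow> bool" where
  "same_alg \<tau> A B \<longleftrightarrow> carrier A = carrier B \<and>
     (\<forall>f n xs. \<tau> f = Some n \<and> length xs = n \<and> set xs \<subseteq> carrier A \<longrightarrow> opn A f xs = opn B f xs)"

definition term_equivalent ::
  "'f signature \<Rightarrow> ('f, 'a) alg set \<Rightarrow> 'g signature \<Rightarrow> ('g, 'a) alg set \<Rightarrow> bool" where
  "term_equivalent \<tau> V \<tau>' W \<longleftrightarrow>
     (\<exists>p q. translation \<tau> \<tau>' p \<and> translation \<tau>' \<tau> q \<and>
        (\<forall>A\<in>V. derived_alg q A \<in> W \<and> same_alg \<tau> (derived_alg p (derived_alg q A)) A) \<and>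
        (\<forall>B\<in>W. derived_alg p B \<in> V \<and> same_alg \<tau>' (derived_alg q (derived_alg p B)) B))"

section \<open>The varieties\<close>

datatype symb = Join | Meet | G nat | F nat | H

definition acts_as_proj :: "('f, 'a) alg \<Rightarrow> 'f \<Rightarrow> nat \<Rightarrow> nat \<Rightarrow> bool" where
  "acts_as_proj A f n i \<longleftrightarrow>
     (\<forall>xs. length xs = n \<and> set xs \<subseteq> carrier A \<longrightarrow> opn A f xs = xs ! (i - 1))"

definition rlat_type :: "nat \<Rightarrow> symb signature" where
  "rlat_type m = [Join \<mapsto> 2, Meet \<mapsto> 2, G m \<mapsto> 1]"

definition is_lattice :: "(symb, 'a) alg \<Rightarrow> bool" where
  "is_lattice A \<longleftrightarrow> is_algebra [Join \<mapsto> 2, Meet \<mapsto> 2] A \<and>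
     (let L = carrier A; j = (\<lambda>x y. opn A Join [x, y]); k = (\<lambda>x y. opn A Meet [x, y]) in
       (\<forall>x\<in>L. \<forall>y\<in>L. j x y = j y x \<and> k x y = k y x) \<and>
       (\<forall>x\<in>L. \<forall>y\<in>L. \<forall>z\<in>L. j (j x y) z = j x (j y z) \<and> k (k x y) z = k x (k y z)) \<and>
       (\<forall>x\<in>L. \<forall>y\<in>L. j x (k x y) = x \<and> k x (j x y) = x))"

definition lattice_automorphism :: "(symb, 'a) alg \<Rightarrow> ('a \<Rightarrow> 'a) \<Rightarrow> bool" where
  "lattice_automorphism A g \<longleftrightarrow> bij_betw g (carrier A) (carrier A) \<and>
     (\<forall>x\<in>carrier A. \<forall>y\<in>carrier A.
        g (opn A Join [x, y]) = opn A Join [g x, g y] \<and>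
        g (opn A Meet [x, y]) = opn A Meet [g x, g y])"

definition RLat :: "nat \<Rightarrow> (symb, 'a) alg set" where
  "RLat m = {A. is_algebra (rlat_type m) A \<and> is_lattice A \<and>
     lattice_automorphism A (\<lambda>x. opn A (G m) [x]) \<and>
     (\<forall>x\<in>carrier A. ((\<lambda>x. opn A (G m) [x]) ^^ m) x = x)}"

definition S_type :: "nat \<Rightarrow> symb signature" where
  "S_type n = (if n = 1 then Map.empty else [F n \<mapsto> n])"

definition S_proj :: "nat \<Rightarrow> nat \<Rightarrow> (symb, 'a) alg set" where
  "S_proj n i = Mod (S_type n) {(App (F n) (map Var [1..<Suc n]), Var i)}"

definition S :: "nat \<Rightarrow> (symb, 'a) alg set" where
  "S n = (if n = 1 then Mod (S_type 1) {}
          else variety_join (S_type n) {S_proj n i | i. 1 \<le> i \<and> i \<le> n})"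

definition C_type :: "nat \<Rightarrow> nat \<Rightarrow> symb signature" where
  "C_type m n = [Join \<mapsto> 2, Meet \<mapsto> 2, G m \<mapsto> 1, F n \<mapsto> n, H \<mapsto> 2]"

definition RLat_ext :: "nat \<Rightarrow> nat \<Rightarrow> (symb, 'a) alg set" where
  "RLat_ext m n = {A. is_algebra (C_type m n) A \<and> A \<in> RLat m \<and>
     acts_as_proj A (F n) n 1 \<and> acts_as_proj A H 2 1}"

text \<open>For \<open>n = 1\<close> the symbol \<open>F 1\<close> is not in the type of \<open>S 1\<close>, so its action is fixed here.\<close>

definition S_ext :: "nat \<Rightarrow> nat \<Rightarrow> (symb, 'a) alg set" where
  "S_ext m n = {A. is_algebra (C_type m n) A \<and> A \<in> S n \<and>
     (n = 1 \<longrightarrow> acts_as_proj A (F 1) 1 1) \<and>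
     acts_as_proj A Join 2 1 \<and> acts_as_proj A Meet 2 1 \<and> acts_as_proj A (G m) 1 1 \<and>
     acts_as_proj A H 2 2}"

definition C :: "nat \<Rightarrow> nat \<Rightarrow> (symb, 'a) alg set" where
  "C m n = variety_join (C_type m n) {RLat_ext m n, S_ext m n}"

end

theory Submission
  imports Defs
begin

text \<open>\<open>C m n\<close> is the join of \<open>n + 1\<close> varieties made independent by the term
  \<open>h(x\<^sub>0, f(x\<^sub>1, \<dots>, x\<^sub>n))\<close>, which acts as the \<open>k\<close>-th projection in the \<open>k\<close>-th of them: the lattices
  with an automorphism for \<open>k = 0\<close>, and sets on which \<open>f\<close> is the \<open>k\<close>-th projection for \<open>k > 0\<close>. So every
  member is a direct product of members of these varieties, a tolerance of it is a product of tolerances,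
  and factorability can be checked in each factor. In a lattice a block is determined by its up-set, and
  the up-set of any block containing \<open>B \<or> D\<close> is the intersection of those of \<open>B\<close> and \<open>D\<close>.

  Term equivalence preserves the relations compatible with an algebra. On a two-element set \<open>{a, b}\<close> there
  are exactly \<open>n\<close> structures from \<open>C m n\<close> compatible with the swap \<open>{(a, b), (b, a)}\<close>; this recovers
  \<open>n\<close>. To recover \<open>m\<close>, take the lattice with bounds and \<open>m\<close> atoms, permuted cyclically: any algebra derived
  from it has the same automorphism and order as compatible relations, which makes its atoms an antichain,
  so that the bounds and an orbit of its own automorphism form a subalgebra. That orbit must then contain
  all atoms.\<close>

section \<open>Homomorphisms and compatible relations\<close>

text \<open>A join is given only as an intersection of varieties, restricted to one HOL type, so a
  member is accessible only through the identities common to the factor varieties over that type.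
  Structural facts are therefore phrased as identities in \<open>dterm\<close> and
  \<open>pterm\<close> and checked in each factor variety. This is also why the factors of a member
  are built inside its own carrier with the help of a base point: classes of a kernel would live
  over another type. Blocks do live over \<open>'a set\<close>; membership of the quotient is
  regained there by embedding it into the quotients of the factors, which are over
  \<open>'a set\<close> too.

  In the comparison of two types little of the diamond is known after translation: the derived
  lattice may be the dual one, and its automorphism is only known to commute with the given one. The
  argument uses what survives this, namely comparabilities, the unordered pair of bounds and
  commutation. An infinite carrier type makes room for diamonds of every size.\<close>

lemma eval_cong_vars:
  "(\<And>x. x \<in> vars t \<Longrightarrow> \<sigma> x = \<sigma>' x) \<Longrightarrow> eval A \<sigma> t = eval A \<sigma>' t"
proof (induction t)
  case (App f ts)
  then have "map (eval A \<sigma>) ts = map (eval A \<sigma>') ts" by auto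
  then show ?case by (simp only: eval.simps)
qed simp

lemma finite_vars: "finite (vars t)"
  by (induction t) auto

lemma is_algebraD:
  "is_algebra \<tau> A \<Longrightarrow> \<tau> f = Some r \<Longrightarrow> length xs = r \<Longrightarrow> set xs \<subseteq> carrier A \<Longrightarrow> opn A f xs \<in> carrier A"
  by (auto simp: is_algebra_def)

lemma eval_in_carrier:
  "is_algebra \<tau> A \<Longrightarrow> wf_trm \<tau> t \<Longrightarrow> (\<And>x. x \<in> vars t \<Longrightarrow> \<sigma> x \<in> carrier A) \<Longrightarrow> eval A \<sigma> t \<in> carrier A"
proof (induction t)
  case (App f ts)
  have "set (map (eval A \<sigma>) ts) \<subseteq> carrier A" using App by auto
  then show ?case using App.prems by (auto intro!: is_algebraD)
qed simp

lemma eval_compatible: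
  "compatible \<tau> A R \<Longrightarrow> wf_trm \<tau> t \<Longrightarrow> (\<And>x. x \<in> vars t \<Longrightarrow> (\<sigma> x, \<sigma>' x) \<in> R)
    \<Longrightarrow> (eval A \<sigma> t, eval A \<sigma>' t) \<in> R"
proof (induction t)
  case (App f ts)
  have "(eval A \<sigma> u, eval A \<sigma>' u) \<in> R" if "u \<in> set ts" for u
    using App.prems that by (intro App.IH) auto
  then have "list_all2 (\<lambda>x y. (x, y) \<in> R) (map (eval A \<sigma>) ts) (map (eval A \<sigma>') ts)"
    by (simp add: list_all2_conv_all_nth)
  then show ?case using App.prems by (auto simp: compatible_def)
qed simp

definition alg_hom :: "'f signature \<Rightarrow> ('f, 'a) alg \<Rightarrow> ('f, 'b) alg \<Rightarrow> ('a \<Rightarrow> 'b) \<Rightarrow> bool" where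
  "alg_hom \<tau> A B h \<longleftrightarrow> (\<forall>x\<in>carrier A. h x \<in> carrier B) \<and>
     (\<forall>f r xs. \<tau> f = Some r \<and> length xs = r \<and> set xs \<subseteq> carrier A \<longrightarrow>
        h (opn A f xs) = opn B f (map h xs))"

lemma eval_alg_hom:
  assumes "is_algebra \<tau> A" "alg_hom \<tau> A B h"
  shows "wf_trm \<tau> t \<Longrightarrow> (\<And>x. x \<in> vars t \<Longrightarrow> \<sigma> x \<in> carrier A)
    \<Longrightarrow> h (eval A \<sigma> t) = eval B (\<lambda>x. h (\<sigma> x)) t"
proof (induction t)
  case (App f ts)
  have 1: "set (map (eval A \<sigma>) ts) \<subseteq> carrier A"
    using App.prems by (auto intro!: eval_in_carrier[OF assms(1)])
  have 2: "map h (map (eval A \<sigma>) ts) = map (eval B (\<lambda>x. h (\<sigma> x))) ts"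
    using App by auto
  have "h (opn A f (map (eval A \<sigma>) ts)) = opn B f (map h (map (eval A \<sigma>) ts))"
    using assms(2) 1 App.prems(1) unfolding alg_hom_def by simp
  then show ?case by (simp only: 2 eval.simps)
qed simp

lemma satisfiesD:
  "satisfies A (s, t) \<Longrightarrow> (\<And>x. \<sigma> x \<in> carrier A) \<Longrightarrow> eval A \<sigma> s = eval A \<sigma> t"
  by (auto simp: satisfies_def)

lemma satisfiesI:
  "(\<And>\<sigma>. (\<And>x. \<sigma> x \<in> carrier A) \<Longrightarrow> eval A \<sigma> s = eval A \<sigma> t) \<Longrightarrow> satisfies A (s, t)"
  by (auto simp: satisfies_def subset_iff)

lemma satisfies_subdirect:
  assumes "is_algebra \<tau> A" "wf_trm \<tau> s" "wf_trm \<tau> t"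
    and "\<And>k. k \<in> I \<Longrightarrow> alg_hom \<tau> A (Q k) (h k)"
    and "\<And>x y. x \<in> carrier A \<Longrightarrow> y \<in> carrier A \<Longrightarrow> (\<And>k. k \<in> I \<Longrightarrow> h k x = h k y) \<Longrightarrow> x = y"
    and "\<And>k. k \<in> I \<Longrightarrow> satisfies (Q k) (s, t)"
  shows "satisfies A (s, t)"
  unfolding satisfies_def fst_conv snd_conv
proof (intro allI impI)
  fix \<sigma> :: "nat \<Rightarrow> _" assume "range \<sigma> \<subseteq> carrier A"
  then have s: "\<And>x. \<sigma> x \<in> carrier A" by auto
  show "eval A \<sigma> s = eval A \<sigma> t"
  proof (rule assms(5))
    fix k assume k: "k \<in> I"
    have "\<And>x. h k (\<sigma> x) \<in> carrier (Q k)" using assms(4)[OF k] s by (auto simp: alg_hom_def)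
    then have "eval (Q k) (\<lambda>x. h k (\<sigma> x)) s = eval (Q k) (\<lambda>x. h k (\<sigma> x)) t"
      by (rule satisfiesD[OF assms(6)[OF k]])
    then show "h k (eval A \<sigma> s) = h k (eval A \<sigma> t)"
      using eval_alg_hom[OF assms(1) assms(4)[OF k], of _ \<sigma>] assms(2,3) s by simp
  qed (use assms s in \<open>auto intro: eval_in_carrier\<close>)
qed

lemma same_alg_hom: "same_alg \<tau> A B \<Longrightarrow> alg_hom \<tau> A B (\<lambda>x. x)"
  by (auto simp: same_alg_def alg_hom_def)

lemma same_alg_sym: "same_alg \<tau> A B \<Longrightarrow> same_alg \<tau> B A"
  by (auto simp: same_alg_def)

lemma same_alg_trans: "same_alg \<tau> A B \<Longrightarrow> same_alg \<tau> B D \<Longrightarrow> same_alg \<tau> A D"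
  by (auto simp: same_alg_def)

lemma is_algebra_same: "same_alg \<tau> A B \<Longrightarrow> is_algebra \<tau> B \<Longrightarrow> is_algebra \<tau> A"
  by (auto simp: same_alg_def is_algebra_def)

lemma satisfies_same:
  assumes "same_alg \<tau> A B" "is_algebra \<tau> B" "wf_trm \<tau> s" "wf_trm \<tau> t" "satisfies B (s, t)"
  shows "satisfies A (s, t)"
  using satisfies_subdirect[OF is_algebra_same[OF assms(1,2)] assms(3,4),
      of UNIV "\<lambda>_::nat. B" "\<lambda>_ x. x"] assms same_alg_hom by blast

lemma variety_Mod: "(\<And>s t. (s, t) \<in> E \<Longrightarrow> wf_trm \<tau> s \<and> wf_trm \<tau> t) \<Longrightarrow> variety \<tau> (Mod \<tau> E)"
  unfolding variety_def by (rule exI[of _ E]) auto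

lemma variety_join_least:
  "variety \<tau> V \<Longrightarrow> (\<And>U. U \<in> K \<Longrightarrow> U \<subseteq> V) \<Longrightarrow> variety_join \<tau> K \<subseteq> V"
  unfolding variety_join_def by (rule Inter_lower) simp

section \<open>The varieties as joins of n + 1 factor varieties\<close>

text \<open>A single component of \<open>S_ext m n\<close>: the sets on which \<open>F n\<close>
  picks argument \<open>k\<close>, counted from 1. Index 0 stays free for the lattices in
  \<open>factor_var\<close>, and the indices match the argument positions of
  \<open>dd\<close>.\<close>

definition proj_var :: "nat \<Rightarrow> nat \<Rightarrow> nat \<Rightarrow> (symb, 'a) alg set" where
  "proj_var m n k = {A. is_algebra (C_type m n) A \<and>
     acts_as_proj A Join 2 1 \<and> acts_as_proj A Meet 2 1 \<and> acts_as_proj A (G m) 1 1 \<and>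
     acts_as_proj A (F n) n k \<and> acts_as_proj A H 2 2}"

definition factor_var :: "nat \<Rightarrow> nat \<Rightarrow> nat \<Rightarrow> (symb, 'a) alg set" where
  "factor_var m n k = (if k = 0 then RLat_ext m n else proj_var m n k)"

lemma C_type_simps [simp]:
  "C_type m n Join = Some 2" "C_type m n Meet = Some 2" "C_type m n H = Some 2"
  "C_type m n (G i) = (if i = m then Some 1 else None)"
  "C_type m n (F i) = (if i = n then Some n else None)"
  by (auto simp: C_type_def)

lemma C_type_cases:
  assumes "C_type m n f = Some r"
  obtains "f = Join" "r = 2" | "f = Meet" "r = 2" | "f = G m" "r = 1" | "f = F n" "r = n" | "f = H" "r = 2"
  using assms by (cases f) (auto split: if_splits)

lemma acts_as_projD:
  "acts_as_proj A f n i \<Longrightarrow> length xs = n \<Longrightarrow> set xs \<subseteq> carrier A \<Longrightarrow> opn A f xs = xs ! (i - 1)"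
  by (auto simp: acts_as_proj_def)

lemma factor_var_algebra: "A \<in> factor_var m n k \<Longrightarrow> is_algebra (C_type m n) A"
  by (auto simp: factor_var_def proj_var_def RLat_ext_def split: if_splits)

lemma S_ext_1: "S_ext m 1 = proj_var m 1 1"
  by (auto simp: S_ext_def proj_var_def S_def Mod_def is_algebra_def S_type_def)

section \<open>Projections as identities\<close>

lemma satisfies_projection:
  assumes "1 \<le> i" "i \<le> r"
  shows "acts_as_proj A f r i \<longleftrightarrow> satisfies A (App f (map Var [0..<r]), Var (i - 1))" (is "?l = ?r")
proof
  assume ?l
  then have "opn A f (map \<sigma> [0..<r]) = \<sigma> (i - 1)" if "range \<sigma> \<subseteq> carrier A" for \<sigma>
    using acts_as_projD[of A f r i "map \<sigma> [0..<r]"] that assms by auto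
  then show ?r by (auto simp: satisfies_def comp_def)
next
  assume r: ?r
  show ?l unfolding acts_as_proj_def
  proof (intro allI impI, elim conjE)
    fix xs assume xs: "length xs = r" "set xs \<subseteq> carrier A"
    \<comment> \<open>A valuation is total, so indices beyond the list reuse its entry 0, which
      exists because \<open>r\<close> is positive.\<close>
    define \<sigma> where "\<sigma> j = xs ! (if j < r then j else 0)" for j
    have "xs ! (if j < r then j else 0) \<in> carrier A" for j
      using xs assms by (intro subsetD[OF xs(2)] nth_mem) auto
    then have "range \<sigma> \<subseteq> carrier A" by (auto simp: \<sigma>_def)
    moreover have "map (eval A \<sigma>) (map Var [0..<r]) = xs"
      using xs by (auto simp: \<sigma>_def intro!: nth_equalityI)
    ultimately have "opn A f xs = \<sigma> (i - 1)"
      using satisfiesD[OF r, of \<sigma>] by auto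
    then show "opn A f xs = xs ! (i - 1)" using assms by (simp add: \<sigma>_def)
  qed
qed

lemma S_proj_iff:
  assumes "2 \<le> n" "1 \<le> k" "k \<le> n"
  shows "A \<in> S_proj n k \<longleftrightarrow> is_algebra (S_type n) A \<and> acts_as_proj A (F n) n k"
proof -
  \<comment> \<open>\<open>S_proj\<close> numbers its variables from 1,
    \<open>satisfies_projection\<close> from 0; each direction shifts the valuation by one.\<close>
  have "satisfies A (App (F n) (map Var [1..<Suc n]), Var k) \<longleftrightarrow>
        satisfies A (App (F n) (map Var [0..<n]), Var (k - 1))" (is "?l = ?r")
  proof
    assume l: ?l
    show ?r unfolding satisfies_def fst_conv snd_conv
    proof (intro allI impI)
      fix \<sigma> :: "nat \<Rightarrow> _" assume "range \<sigma> \<subseteq> carrier A"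
      then have "range (\<lambda>x. \<sigma> (x - 1)) \<subseteq> carrier A" by auto
      with l have "eval A (\<lambda>x. \<sigma> (x - 1)) (App (F n) (map Var [1..<Suc n])) = \<sigma> (k - 1)"
        unfolding satisfies_def by auto
      moreover have "map (\<lambda>x. \<sigma> (x - 1)) [1..<Suc n] = map \<sigma> [0..<n]"
        by (rule nth_equalityI) (auto simp del: upt_Suc)
      ultimately show "eval A \<sigma> (App (F n) (map Var [0..<n])) = eval A \<sigma> (Var (k - 1))"
        by (simp add: comp_def del: upt_Suc)
    qed
  next
    assume l: ?r
    show ?l unfolding satisfies_def fst_conv snd_conv
    proof (intro allI impI)
      fix \<sigma> :: "nat \<Rightarrow> _" assume "range \<sigma> \<subseteq> carrier A"
      then have "range (\<lambda>x. \<sigma> (Suc x)) \<subseteq> carrier A" by auto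
      with l have "eval A (\<lambda>x. \<sigma> (Suc x)) (App (F n) (map Var [0..<n])) = \<sigma> k"
        using assms unfolding satisfies_def by auto
      moreover have "map (\<lambda>x. \<sigma> (Suc x)) [0..<n] = map \<sigma> [1..<Suc n]"
        by (rule nth_equalityI) (auto simp del: upt_Suc)
      ultimately show "eval A \<sigma> (App (F n) (map Var [1..<Suc n])) = eval A \<sigma> (Var k)"
        by (simp add: comp_def del: upt_Suc)
    qed
  qed
  then show ?thesis by (simp add: S_proj_def Mod_def satisfies_projection[OF assms(2,3)] del: upt_Suc)
qed

text \<open>\<open>S n\<close> only constrains terms of type \<open>S_type n\<close>; in \<open>S_ext m n\<close> every term has the same value as one
  of these.\<close>

fun proj_reduct :: "symb trm \<Rightarrow> symb trm" where
  "proj_reduct (Var x) = Var x"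
| "proj_reduct (App f ts) = (case f of
     F n \<Rightarrow> App (F n) (map proj_reduct ts)
   | H \<Rightarrow> map proj_reduct ts ! 1
   | _ \<Rightarrow> map proj_reduct ts ! 0)"

lemma wf_proj_reduct:
  "2 \<le> n \<Longrightarrow> wf_trm (C_type m n) t \<Longrightarrow> wf_trm (S_type n) (proj_reduct t)"
proof (induction t)
  case (App f ts)
  have "\<And>t. t \<in> set ts \<Longrightarrow> wf_trm (S_type n) (proj_reduct t)" using App by auto
  then have 1: "\<And>i. i < length ts \<Longrightarrow> wf_trm (S_type n) (proj_reduct (ts ! i))" by simp
  have f: "C_type m n f = Some (length ts)" using App.prems by simp
  have F: "S_type n (F n) = Some n" using App.prems by (simp add: S_type_def)
  from f show ?case
    by (rule C_type_cases) (use 1 F in \<open>auto simp: in_set_conv_nth\<close>)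
qed simp

lemma eval_proj_reduct:
  assumes "is_algebra (C_type m n) A" "acts_as_proj A Join 2 1" "acts_as_proj A Meet 2 1"
    "acts_as_proj A (G m) 1 1" "acts_as_proj A H 2 2" "\<And>x. \<sigma> x \<in> carrier A"
  shows "wf_trm (C_type m n) t \<Longrightarrow> eval A \<sigma> (proj_reduct t) = eval A \<sigma> t"
proof (induction t)
  case (App f ts)
  let ?xs = "map (eval A \<sigma>) ts"
  have 1: "set ?xs \<subseteq> carrier A" using App.prems
    by (auto intro!: eval_in_carrier[OF assms(1)] assms(6))
  have 2: "map (eval A \<sigma> \<circ> proj_reduct) ts = ?xs" using App by auto
  have 3: "eval A \<sigma> (proj_reduct (ts ! i)) = eval A \<sigma> (ts ! i)" if "i < length ts" for i
    using App that by auto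
  have f: "C_type m n f = Some (length ts)" using App.prems by simp
  then show ?case
  proof (rule C_type_cases)
    assume "f = F n" then show ?thesis by (simp add: 2)
  qed (use acts_as_projD[OF assms(2) _ 1] acts_as_projD[OF assms(3) _ 1] acts_as_projD[OF assms(4) _ 1]
      acts_as_projD[OF assms(5) _ 1] 3 in auto)
qed simp

text \<open>Reducing both sides turns an identity of the larger type into one of type
  \<open>S_type n\<close>. That one holds in every generator \<open>S_proj n k\<close>, hence in
  their join, and the reduction does not change values in \<open>A\<close>.\<close>

lemma S_ext_satisfies:
  fixes A :: "(symb, 'a) alg"
  assumes n: "1 \<le> n" and wf: "wf_trm (C_type m n) s" "wf_trm (C_type m n) t"
    and sat: "\<And>k B. 1 \<le> k \<Longrightarrow> k \<le> n \<Longrightarrow> (B :: (symb, 'a) alg) \<in> proj_var m n k \<Longrightarrow> satisfies B (s, t)"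
    and A: "A \<in> S_ext m n"
  shows "satisfies A (s, t)"
proof (cases "n = 1")
  case True
  then show ?thesis using sat[of 1 A] A S_ext_1 by auto
next
  case False
  with n have n: "2 \<le> n" by simp
  let ?e = "(proj_reduct s, proj_reduct t)"
  have "satisfies B ?e" if k: "1 \<le> k" "k \<le> n" and B: "B \<in> S_proj n k" for k and B :: "(symb, 'a) alg"
  proof -
    \<comment> \<open>The expansion of \<open>B\<close> to type \<open>C_type m n\<close> by the
      projections prescribed for the missing symbols, which makes it a member of
      \<open>proj_var m n k\<close>.\<close>
    define D where "D = B\<lparr>opn := (\<lambda>f xs. case f of F i \<Rightarrow> opn B f xs | H \<Rightarrow> xs ! 1 | _ \<Rightarrow> xs ! 0)\<rparr>"
    have B': "is_algebra (S_type n) B" "acts_as_proj B (F n) n k" using B S_proj_iff[OF n k] by auto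
    have [simp]: "carrier D = carrier B" by (simp add: D_def)
    have "opn D f xs \<in> carrier B"
      if f: "C_type m n f = Some r" and xs: "length xs = r" "set xs \<subseteq> carrier B" for f r xs
    proof -
      have 1: "i < r \<Longrightarrow> xs ! i \<in> carrier B" for i using xs by auto
      have 2: "f = F n \<Longrightarrow> opn B f xs \<in> carrier B" using B'(1) n xs f
        by (auto simp: is_algebra_def S_type_def)
      show ?thesis using f by (rule C_type_cases) (use 1 2 in \<open>auto simp: D_def\<close>)
    qed
    then have 1: "is_algebra (C_type m n) D" using B'(1)
      by (simp add: is_algebra_def)
    have 2: "acts_as_proj D Join 2 1" "acts_as_proj D Meet 2 1" "acts_as_proj D (G m) 1 1"
       "acts_as_proj D (F n) n k" "acts_as_proj D H 2 2"
      using B'(2) by (auto simp: acts_as_proj_def D_def)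
    have D: "satisfies D (s, t)" using sat[OF k] 1 2 by (auto simp: proj_var_def)
    have 3: "alg_hom (S_type n) B D (\<lambda>x. x)" using n by (auto simp: alg_hom_def D_def S_type_def split: if_splits)
    have "eval B \<sigma> (proj_reduct s) = eval B \<sigma> (proj_reduct t)" if s: "\<And>x. \<sigma> x \<in> carrier B" for \<sigma>
    proof -
      have "eval B \<sigma> (proj_reduct u) = eval D \<sigma> u" if "wf_trm (C_type m n) u" for u
        using eval_alg_hom[OF B'(1) 3 wf_proj_reduct[OF n that] s]
          eval_proj_reduct[OF 1 2(1-3,5) _ that, of \<sigma>] s by simp
      then show ?thesis using wf satisfiesD[OF D, of \<sigma>] s by simp
    qed
    then show ?thesis by (auto simp: satisfies_def)
  qed
  then have "S_proj n k \<subseteq> (Mod (S_type n) {?e} :: (symb, 'a) alg set)" if "1 \<le> k" "k \<le> n" for k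
    using that by (auto simp: Mod_def S_proj_iff[OF n that])
  moreover have "A \<in> variety_join (S_type n) {S_proj n i | i. 1 \<le> i \<and> i \<le> n}"
    using A n by (auto simp: S_ext_def S_def)
  moreover have "variety (S_type n) (Mod (S_type n) {?e})"
    by (rule variety_Mod) (simp add: wf_proj_reduct[OF n wf(1)] wf_proj_reduct[OF n wf(2)])
  ultimately have "A \<in> Mod (S_type n) {?e}"
    using variety_join_least[of "S_type n" "Mod (S_type n) {?e}" "{S_proj n i | i. 1 \<le> i \<and> i \<le> n}"] by fastforce
  then have "satisfies A ?e" by (simp add: Mod_def)
  have "eval A \<sigma> s = eval A \<sigma> t" if s: "\<And>x. \<sigma> x \<in> carrier A" for \<sigma>
  proof -
    have "eval A \<sigma> (proj_reduct u) = eval A \<sigma> u" if "wf_trm (C_type m n) u" for u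
      using A by (intro eval_proj_reduct[OF _ _ _ _ _ s that]) (simp_all add: S_ext_def)
    then show ?thesis using wf satisfiesD[OF \<open>satisfies A ?e\<close>, of \<sigma>] s by simp
  qed
  then show ?thesis by (auto simp: satisfies_def)
qed

lemma factor_var_subset:
  assumes n: "1 \<le> n" and k: "k \<le> n" and A: "A \<in> factor_var m n k"
  shows "A \<in> RLat_ext m n \<union> S_ext m n"
proof (cases "k = 0 \<or> n = 1")
  case True
  then consider "k = 0" | "n = 1" "k = 1" using k by fastforce
  then show ?thesis by cases (use A S_ext_1[of m] in \<open>auto simp: factor_var_def\<close>)
next
  case False
  with assms have A': "A \<in> proj_var m n k" and k: "1 \<le> k" "k \<le> n" "2 \<le> n" by (auto simp: factor_var_def)
  then have "is_algebra (S_type n) A" by (auto simp: proj_var_def is_algebra_def S_type_def split: if_splits)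
  then have "A \<in> S_proj n k" using A' k by (auto simp: S_proj_iff proj_var_def)
  then have "A \<in> S n" using k by (auto simp: S_def variety_join_def)
  then show ?thesis using A' k by (auto simp: S_ext_def proj_var_def)
qed

text \<open>Any variety above both summands is given by identities, and these hold in all factor
  varieties because every member of a factor variety lies in a summand.\<close>

lemma C_I:
  fixes A :: "(symb, 'a) alg"
  assumes n: "1 \<le> n" and A: "is_algebra (C_type m n) A"
    and sat: "\<And>s t. wf_trm (C_type m n) s \<Longrightarrow> wf_trm (C_type m n) t \<Longrightarrow>
      (\<And>k B. k \<le> n \<Longrightarrow> (B :: (symb, 'a) alg) \<in> factor_var m n k \<Longrightarrow> satisfies B (s, t)) \<Longrightarrow> satisfies A (s, t)"
  shows "A \<in> C m n"
  unfolding C_def variety_join_def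
proof (intro InterI, elim CollectE conjE)
  fix V assume V: "variety (C_type m n) V" "\<forall>U\<in>{RLat_ext m n, S_ext m n}. U \<subseteq> (V :: (symb, 'a) alg set)"
  then obtain E where E: "\<forall>(s, t)\<in>E. wf_trm (C_type m n) s \<and> wf_trm (C_type m n) t" "V = Mod (C_type m n) E"
    by (auto simp: variety_def)
  have "satisfies A e" if e: "e \<in> E" for e
  proof (cases e)
    case (Pair s t)
    have "satisfies B (s, t)" if "k \<le> n" "(B :: (symb, 'a) alg) \<in> factor_var m n k" for k B
      using factor_var_subset[OF n that] V(2) E(2) e Pair by (auto simp: Mod_def)
    then show ?thesis using E(1) e sat[of s t] Pair by blast
  qed
  then show "A \<in> V" using A E by (auto simp: Mod_def)
qed

lemma C_least:
  "variety (C_type m n) V \<Longrightarrow> RLat_ext m n \<subseteq> V \<Longrightarrow> S_ext m n \<subseteq> V \<Longrightarrow> C m n \<subseteq> V"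
  unfolding C_def by (rule variety_join_least) auto

lemma C_algebra:
  assumes "A \<in> C m n"
  shows "is_algebra (C_type m n) A"
proof -
  have "C m n \<subseteq> Mod (C_type m n) {}"
    by (rule C_least[OF variety_Mod]) (auto simp: Mod_def RLat_ext_def S_ext_def)
  then show ?thesis using assms by (auto simp: Mod_def)
qed

text \<open>The models of one identity form a variety; it contains both summands by the hypothesis
  and \<open>S_ext_satisfies\<close>, so it contains their join.\<close>

lemma C_satisfies:
  fixes A :: "(symb, 'a) alg"
  assumes n: "1 \<le> n" and A: "A \<in> C m n" and wf: "wf_trm (C_type m n) s" "wf_trm (C_type m n) t"
    and sat: "\<And>k B. k \<le> n \<Longrightarrow> (B :: (symb, 'a) alg) \<in> factor_var m n k \<Longrightarrow> satisfies B (s, t)"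
  shows "satisfies A (s, t)"
proof -
  let ?V = "Mod (C_type m n) {(s, t)} :: (symb, 'a) alg set"
  have "variety (C_type m n) ?V" by (rule variety_Mod) (use wf in simp)
  moreover have "RLat_ext m n \<subseteq> ?V" using sat[of 0] by (auto simp: factor_var_def Mod_def RLat_ext_def)
  moreover have "satisfies B (s, t)" if "B \<in> S_ext m n" for B :: "(symb, 'a) alg"
  proof (rule S_ext_satisfies[OF n wf _ that])
    fix k and B :: "(symb, 'a) alg" assume "1 \<le> k" "k \<le> n" "B \<in> proj_var m n k"
    then show "satisfies B (s, t)" using sat[of k B] by (auto simp: factor_var_def)
  qed
  then have "S_ext m n \<subseteq> ?V" by (auto simp: Mod_def S_ext_def)
  ultimately have "A \<in> ?V" using A C_least by blast
  then show ?thesis by (simp add: Mod_def)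
qed

subsection \<open>The factor varieties\<close>

lemma RLat_extD:
  assumes "A \<in> RLat_ext m n"
  shows "x \<in> carrier A \<Longrightarrow> y \<in> carrier A \<Longrightarrow> opn A Join [x, y] \<in> carrier A"
    and "x \<in> carrier A \<Longrightarrow> y \<in> carrier A \<Longrightarrow> opn A Meet [x, y] \<in> carrier A"
    and "x \<in> carrier A \<Longrightarrow> opn A (G m) [x] \<in> carrier A"
    and "x \<in> carrier A \<Longrightarrow> y \<in> carrier A \<Longrightarrow> opn A Join [x, y] = opn A Join [y, x]"
    and "x \<in> carrier A \<Longrightarrow> y \<in> carrier A \<Longrightarrow> opn A Meet [x, y] = opn A Meet [y, x]"
    and "x \<in> carrier A \<Longrightarrow> y \<in> carrier A \<Longrightarrow> z \<in> carrier A \<Longrightarrow>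
      opn A Join [opn A Join [x, y], z] = opn A Join [x, opn A Join [y, z]]"
    and "x \<in> carrier A \<Longrightarrow> y \<in> carrier A \<Longrightarrow> z \<in> carrier A \<Longrightarrow>
      opn A Meet [opn A Meet [x, y], z] = opn A Meet [x, opn A Meet [y, z]]"
    and "x \<in> carrier A \<Longrightarrow> y \<in> carrier A \<Longrightarrow> opn A Join [x, opn A Meet [x, y]] = x"
    and "x \<in> carrier A \<Longrightarrow> y \<in> carrier A \<Longrightarrow> opn A Meet [x, opn A Join [x, y]] = x"
    and "x \<in> carrier A \<Longrightarrow> y \<in> carrier A \<Longrightarrow>
      opn A (G m) [opn A Join [x, y]] = opn A Join [opn A (G m) [x], opn A (G m) [y]]"
    and "x \<in> carrier A \<Longrightarrow> y \<in> carrier A \<Longrightarrow>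
      opn A (G m) [opn A Meet [x, y]] = opn A Meet [opn A (G m) [x], opn A (G m) [y]]"
    and "x \<in> carrier A \<Longrightarrow> ((\<lambda>x. opn A (G m) [x]) ^^ m) x = x"
    and "acts_as_proj A (F n) n 1" and "acts_as_proj A H 2 1" and "is_algebra (C_type m n) A"
proof -
  have A: "A \<in> RLat m" "is_algebra (C_type m n) A" using assms by (auto simp: RLat_ext_def)
  show "x \<in> carrier A \<Longrightarrow> y \<in> carrier A \<Longrightarrow> opn A Join [x, y] \<in> carrier A"
    "x \<in> carrier A \<Longrightarrow> y \<in> carrier A \<Longrightarrow> opn A Meet [x, y] \<in> carrier A"
    "x \<in> carrier A \<Longrightarrow> opn A (G m) [x] \<in> carrier A"
    using is_algebraD[OF A(2)] by auto
qed (use assms in \<open>simp_all add: RLat_ext_def RLat_def is_lattice_def lattice_automorphism_def Let_def\<close>)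

lemma bij_betw_funpow_id:
  assumes "\<And>x. x \<in> X \<Longrightarrow> g x \<in> X" "\<And>x. x \<in> X \<Longrightarrow> (g ^^ r) x = x" "1 \<le> r"
  shows "bij_betw g X X"
proof (rule bij_betw_byWitness[where f' = "g ^^ (r - 1)"])
  have cl: "(g ^^ j) x \<in> X" if "x \<in> X" for j x
    using that assms(1) by (induction j) auto
  have r: "r = Suc (r - 1)" using assms(3) by simp
  have "(g ^^ (r - 1)) (g x) = (g ^^ r) x" "g ((g ^^ (r - 1)) x) = (g ^^ r) x" for x
    by (subst (2) r, simp add: funpow_swap1)+
  then show "\<forall>x\<in>X. (g ^^ (r - 1)) (g x) = x" "\<forall>x\<in>X. g ((g ^^ (r - 1)) x) = x"
    using assms(2) by auto
  show "g ` X \<subseteq> X" "(g ^^ (r - 1)) ` X \<subseteq> X" using cl assms(1) by auto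
qed

text \<open>Bijectivity of the rotation is not an identity, but it follows from the period, the
  inverse being the power with exponent \<open>m - 1\<close>. What remains to be checked is purely
  equational, as \<open>factor_var_closed\<close> requires.\<close>

lemma RLat_extI:
  assumes alg: "is_algebra (C_type m n) A" and m: "1 \<le> m"
    and "\<And>x y. x \<in> carrier A \<Longrightarrow> y \<in> carrier A \<Longrightarrow> opn A Join [x, y] = opn A Join [y, x]"
    and "\<And>x y. x \<in> carrier A \<Longrightarrow> y \<in> carrier A \<Longrightarrow> opn A Meet [x, y] = opn A Meet [y, x]"
    and "\<And>x y z. x \<in> carrier A \<Longrightarrow> y \<in> carrier A \<Longrightarrow> z \<in> carrier A \<Longrightarrow>
      opn A Join [opn A Join [x, y], z] = opn A Join [x, opn A Join [y, z]]"
    and "\<And>x y z. x \<in> carrier A \<Longrightarrow> y \<in> carrier A \<Longrightarrow> z \<in> carrier A \<Longrightarrow>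
      opn A Meet [opn A Meet [x, y], z] = opn A Meet [x, opn A Meet [y, z]]"
    and "\<And>x y. x \<in> carrier A \<Longrightarrow> y \<in> carrier A \<Longrightarrow> opn A Join [x, opn A Meet [x, y]] = x"
    and "\<And>x y. x \<in> carrier A \<Longrightarrow> y \<in> carrier A \<Longrightarrow> opn A Meet [x, opn A Join [x, y]] = x"
    and "\<And>x y. x \<in> carrier A \<Longrightarrow> y \<in> carrier A \<Longrightarrow>
      opn A (G m) [opn A Join [x, y]] = opn A Join [opn A (G m) [x], opn A (G m) [y]]"
    and "\<And>x y. x \<in> carrier A \<Longrightarrow> y \<in> carrier A \<Longrightarrow>
      opn A (G m) [opn A Meet [x, y]] = opn A Meet [opn A (G m) [x], opn A (G m) [y]]"
    and gm: "\<And>x. x \<in> carrier A \<Longrightarrow> ((\<lambda>x. opn A (G m) [x]) ^^ m) x = x"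
    and "acts_as_proj A (F n) n 1" and "acts_as_proj A H 2 1"
  shows "A \<in> RLat_ext m n"
proof -
  have "is_algebra (rlat_type m) A" "is_algebra [Join \<mapsto> 2, Meet \<mapsto> 2] A"
    using alg by (auto simp: is_algebra_def rlat_type_def split: if_splits)
  moreover have "bij_betw (\<lambda>x. opn A (G m) [x]) (carrier A) (carrier A)"
    by (rule bij_betw_funpow_id[OF _ gm m]) (auto intro: is_algebraD[OF alg])
  ultimately show ?thesis using assms
    unfolding RLat_ext_def RLat_def is_lattice_def lattice_automorphism_def Let_def
    by (intro CollectI conjI ballI) simp_all
qed

lemma eval_funpow:
  "eval A \<sigma> (((\<lambda>t. App f [t]) ^^ r) t) = ((\<lambda>x. opn A f [x]) ^^ r) (eval A \<sigma> t)"
  by (induction r) auto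

lemma wf_funpow: "\<tau> f = Some 1 \<Longrightarrow> wf_trm \<tau> t \<Longrightarrow> wf_trm \<tau> (((\<lambda>t. App f [t]) ^^ r) t)"
  by (induction r) auto

text \<open>All conditions left by \<open>RLat_extI\<close>, and all those of
  \<open>proj_var\<close>, are identities, each obtained from an instance of \<open>sat\<close>.
  Membership of algebras such as \<open>fac\<close> can thus be derived from their identities
  alone.\<close>

lemma factor_var_closed:
  fixes A :: "(symb, 'a) alg"
  assumes m: "1 \<le> m" and n: "1 \<le> n" and k: "k \<le> n" and alg: "is_algebra (C_type m n) A"
    and sat: "\<And>s t. wf_trm (C_type m n) s \<Longrightarrow> wf_trm (C_type m n) t \<Longrightarrow>
      (\<And>B. (B :: (symb, 'a) alg) \<in> factor_var m n k \<Longrightarrow> satisfies B (s, t)) \<Longrightarrow> satisfies A (s, t)"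
  shows "A \<in> factor_var m n k"
proof -
  have proj: "acts_as_proj A f r i" if "1 \<le> i" "i \<le> r" "C_type m n f = Some r"
    "\<And>B :: (symb, 'a) alg. B \<in> factor_var m n k \<Longrightarrow> acts_as_proj B f r i" for f r i
    unfolding satisfies_projection[OF that(1,2)]
    by (rule sat) (use that in \<open>simp_all add: satisfies_projection[OF that(1,2), symmetric] del: One_nat_def\<close>)
  show ?thesis
  proof (cases "k = 0")
    case False
    then show ?thesis using proj n k alg
      by (auto simp: factor_var_def proj_var_def)
  next
    case True
    then have fv: "factor_var m n k = (RLat_ext m n :: (symb, 'a) alg set)" by (simp add: factor_var_def)
    have sat': "eval A \<sigma> s = eval A \<sigma> t"
      if "wf_trm (C_type m n) s" "wf_trm (C_type m n) t" "\<And>i. \<sigma> i \<in> carrier A"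
        "\<And>B \<sigma>. (B :: (symb, 'a) alg) \<in> RLat_ext m n \<Longrightarrow> (\<And>i. \<sigma> i \<in> carrier B) \<Longrightarrow> eval B \<sigma> s = eval B \<sigma> t"
      for s t \<sigma>
      by (rule satisfiesD[OF sat]) (use that fv in \<open>auto intro!: satisfiesI\<close>)
    \<comment> \<open>A valuation for identities in up to three variables; those in fewer variables
      reuse \<open>x\<close> for the third.\<close>
    define v where "v x y z i = (if i = 0 then x else if i = 1 then y else z)" for x y z :: 'a and i :: nat
    have v: "v x y z i \<in> carrier A" if "x \<in> carrier A" "y \<in> carrier A" "z \<in> carrier A" for x y z i
      using that by (simp add: v_def)
    let ?j = "\<lambda>s t. App Join [s, t]" and ?k = "\<lambda>s t. App Meet [s, t]" and ?g = "\<lambda>s. App (G m) [s]"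
    let ?x = "Var 0" and ?y = "Var 1" and ?z = "Var 2"
    have "A \<in> RLat_ext m n"
    proof (rule RLat_extI[OF alg m])
      fix x y z assume x: "x \<in> carrier A" and y: "y \<in> carrier A"
      note vv = v[OF x y x]
      show "opn A Join [x, y] = opn A Join [y, x]"
        using sat'[of "?j ?x ?y" "?j ?y ?x" "v x y x", OF _ _ vv] by (simp add: RLat_extD(4) v_def)
      show "opn A Meet [x, y] = opn A Meet [y, x]"
        using sat'[of "?k ?x ?y" "?k ?y ?x" "v x y x", OF _ _ vv] by (simp add: RLat_extD(5) v_def)
      show "opn A Join [x, opn A Meet [x, y]] = x"
        using sat'[of "?j ?x (?k ?x ?y)" "?x" "v x y x", OF _ _ vv] by (simp add: RLat_extD(8) v_def)
      show "opn A Meet [x, opn A Join [x, y]] = x"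
        using sat'[of "?k ?x (?j ?x ?y)" "?x" "v x y x", OF _ _ vv] by (simp add: RLat_extD(9) v_def)
      show "opn A (G m) [opn A Join [x, y]] = opn A Join [opn A (G m) [x], opn A (G m) [y]]"
        using sat'[of "?g (?j ?x ?y)" "?j (?g ?x) (?g ?y)" "v x y x", OF _ _ vv] by (simp add: RLat_extD(10) v_def)
      show "opn A (G m) [opn A Meet [x, y]] = opn A Meet [opn A (G m) [x], opn A (G m) [y]]"
        using sat'[of "?g (?k ?x ?y)" "?k (?g ?x) (?g ?y)" "v x y x", OF _ _ vv] by (simp add: RLat_extD(11) v_def)
      show "((\<lambda>x. opn A (G m) [x]) ^^ m) x = x"
        using sat'[of "(?g ^^ m) ?x" "?x" "v x y x", OF _ _ vv] by (simp add: RLat_extD(12) v_def eval_funpow wf_funpow)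
      assume z: "z \<in> carrier A"
      note vv = v[OF x y z]
      show "opn A Join [opn A Join [x, y], z] = opn A Join [x, opn A Join [y, z]]"
        using sat'[of "?j (?j ?x ?y) ?z" "?j ?x (?j ?y ?z)" "v x y z", OF _ _ vv] by (simp add: RLat_extD(6) v_def)
      show "opn A Meet [opn A Meet [x, y], z] = opn A Meet [x, opn A Meet [y, z]]"
        using sat'[of "?k (?k ?x ?y) ?z" "?k ?x (?k ?y ?z)" "v x y z", OF _ _ vv] by (simp add: RLat_extD(7) v_def)
    next
      show "acts_as_proj A (F n) n 1" "acts_as_proj A H 2 1"
        by (rule proj; use n fv RLat_extD(13,14) in auto)+
    qed
    then show ?thesis using fv by simp
  qed
qed

subsection \<open>Direct decompositions\<close>

text \<open>\<open>prj n A c k\<close> replaces all coordinates but the \<open>k\<close>-th by those of the base point \<open>c\<close>. Its image is not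
  a subalgebra, so in \<open>fac\<close> every operation is followed by the projection.\<close>

definition dterm :: "nat \<Rightarrow> symb trm list \<Rightarrow> symb trm" where
  "dterm n ts = App H [ts ! 0, App (F n) (tl ts)]"

definition dd :: "nat \<Rightarrow> (symb, 'a) alg \<Rightarrow> 'a list \<Rightarrow> 'a" where
  "dd n A xs = opn A H [xs ! 0, opn A (F n) (tl xs)]"

definition prj :: "nat \<Rightarrow> (symb, 'a) alg \<Rightarrow> 'a \<Rightarrow> nat \<Rightarrow> 'a \<Rightarrow> 'a" where
  "prj n A c k x = dd n A ((replicate (Suc n) c)[k := x])"

text \<open>The term behind \<open>prj\<close>, with the base point held by variable
  \<open>v\<close>, so that statements about \<open>prj\<close> become identities.\<close>

definition pterm :: "nat \<Rightarrow> nat \<Rightarrow> nat \<Rightarrow> symb trm \<Rightarrow> symb trm" where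
  "pterm n v k t = dterm n ((replicate (Suc n) (Var v))[k := t])"

definition fac :: "nat \<Rightarrow> (symb, 'a) alg \<Rightarrow> 'a \<Rightarrow> nat \<Rightarrow> (symb, 'a) alg" where
  "fac n A c k = \<lparr>carrier = prj n A c k ` carrier A, opn = (\<lambda>f xs. prj n A c k (opn A f xs))\<rparr>"

lemma wf_dterm:
  "length ts = Suc n \<Longrightarrow> (\<And>t. t \<in> set ts \<Longrightarrow> wf_trm (C_type m n) t) \<Longrightarrow> wf_trm (C_type m n) (dterm n ts)"
  by (cases ts) (auto simp: dterm_def)

lemma eval_dterm: "length ts = Suc n \<Longrightarrow> eval A \<sigma> (dterm n ts) = dd n A (map (eval A \<sigma>) ts)"
  by (cases ts) (auto simp: dterm_def dd_def)

lemma wf_pterm_args: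
  assumes "wf_trm \<tau> t" "u \<in> set ((replicate r (Var v))[k := t])"
  shows "wf_trm \<tau> u"
proof -
  have "u \<in> insert t (set (replicate r (Var v)))" using set_update_subset_insert assms(2) by fast
  then show ?thesis using assms(1) by auto
qed

lemma wf_pterm: "wf_trm (C_type m n) t \<Longrightarrow> wf_trm (C_type m n) (pterm n v k t)"
  unfolding pterm_def by (rule wf_dterm) (simp_all add: wf_pterm_args del: replicate_Suc)

lemma eval_pterm: "eval A \<sigma> (pterm n v k t) = prj n A (\<sigma> v) k (eval A \<sigma> t)"
  by (simp add: pterm_def prj_def eval_dterm map_update del: replicate_Suc)

lemma dd_factor:
  assumes "B \<in> factor_var m n k" "k \<le> n" "length xs = Suc n" "set xs \<subseteq> carrier B"
  shows "dd n B xs = xs ! k"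
proof -
  obtain x ys where xs: "xs = x # ys" "length ys = n" using assms(3) by (cases xs) auto
  have c: "opn B (F n) ys \<in> carrier B"
    by (rule is_algebraD[OF factor_var_algebra[OF assms(1)]]) (use xs assms in auto)
  show ?thesis
  proof (cases "k = 0")
    case True
    then have "acts_as_proj B H 2 1" using assms(1) by (simp add: factor_var_def RLat_ext_def)
    from acts_as_projD[OF this, of "[x, opn B (F n) ys]"] show ?thesis
      using True c xs assms(4) by (simp add: dd_def)
  next
    case False
    then have "acts_as_proj B H 2 2" "acts_as_proj B (F n) n k"
      using assms(1) by (simp_all add: factor_var_def proj_var_def)
    from acts_as_projD[OF this(1), of "[x, opn B (F n) ys]"] acts_as_projD[OF this(2), of ys]
    show ?thesis using False c xs assms by (simp add: dd_def)
  qed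
qed

lemma eval_dterm_factor:
  assumes "B \<in> factor_var m n l" "l \<le> n" "length ts = Suc n" "\<And>t. t \<in> set ts \<Longrightarrow> wf_trm (C_type m n) t"
    and "\<And>x. \<sigma> x \<in> carrier B"
  shows "eval B \<sigma> (dterm n ts) = eval B \<sigma> (ts ! l)"
proof -
  have "set (map (eval B \<sigma>) ts) \<subseteq> carrier B"
    using assms by (auto intro!: eval_in_carrier[OF factor_var_algebra[OF assms(1)]])
  then show ?thesis using assms by (simp add: eval_dterm dd_factor)
qed

lemma eval_pterm_factor:
  assumes "B \<in> factor_var m n l" "l \<le> n" "wf_trm (C_type m n) t" "\<And>x. \<sigma> x \<in> carrier B"
  shows "eval B \<sigma> (pterm n v k t) = (if k = l then eval B \<sigma> t else \<sigma> v)"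
proof -
  note wf_pterm_args[OF assms(3), where r = "Suc n"]
  then have "eval B \<sigma> (pterm n v k t) = eval B \<sigma> ((replicate (Suc n) (Var v))[k := t] ! l)"
    unfolding pterm_def using assms by (intro eval_dterm_factor) (auto simp del: replicate_Suc)
  then show ?thesis using assms(2) by (simp add: nth_list_update del: replicate_Suc)
qed

locale C_member =
  fixes m n :: nat and A :: "(symb, 'a) alg" and c :: 'a
  assumes m: "1 \<le> m" and n: "1 \<le> n" and A: "A \<in> C m n" and c: "c \<in> carrier A"
begin

abbreviation \<pi> :: "nat \<Rightarrow> 'a \<Rightarrow> 'a" where "\<pi> \<equiv> prj n A c"

lemma alg: "is_algebra (C_type m n) A"
  using A by (rule C_algebra)

lemma dd_closed: "length xs = Suc n \<Longrightarrow> set xs \<subseteq> carrier A \<Longrightarrow> dd n A xs \<in> carrier A"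
  by (cases xs) (auto simp: dd_def intro!: is_algebraD[OF alg])

lemma prj_args: "x \<in> carrier A \<Longrightarrow> set ((replicate (Suc n) c)[k := x]) \<subseteq> carrier A"
  using set_update_subset_insert[of "replicate (Suc n) c" k x] c by auto

lemma prj_closed: "x \<in> carrier A \<Longrightarrow> \<pi> k x \<in> carrier A"
  unfolding prj_def using prj_args by (intro dd_closed) (simp_all del: replicate_Suc)

lemma prj_dd:
  assumes k: "k \<le> n" and xs: "length xs = Suc n" "set xs \<subseteq> carrier A"
  shows "\<pi> k (dd n A xs) = \<pi> k (xs ! k)"
proof -
  \<comment> \<open>Variables up to \<open>n\<close> carry the entries; \<open>Suc n\<close>, like
    every later one, carries the base point, so that \<open>pterm n (Suc n)\<close> evaluates to
    \<open>\<pi>\<close>.\<close>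
  define \<sigma> where "\<sigma> j = (if j \<le> n then xs ! j else c)" for j
  let ?d = "dterm n (map Var [0..<Suc n])"
  have wf: "wf_trm (C_type m n) ?d" by (rule wf_dterm) auto
  have "satisfies A (pterm n (Suc n) k ?d, pterm n (Suc n) k (Var k))"
  proof (rule C_satisfies[OF n A wf_pterm[OF wf] wf_pterm], goal_cases)
    case (2 l B)
    show ?case
    proof (rule satisfiesI)
      fix \<sigma> :: "nat \<Rightarrow> 'a" assume s: "\<And>x. \<sigma> x \<in> carrier B"
      have "eval B \<sigma> ?d = \<sigma> l"
        using 2 s by (subst eval_dterm_factor) (auto simp del: upt_Suc)
      then show "eval B \<sigma> (pterm n (Suc n) k ?d) = eval B \<sigma> (pterm n (Suc n) k (Var k))"
        using 2 s wf by (simp add: eval_pterm_factor[OF 2(2) 2(1)])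
    qed
  qed simp
  moreover have "\<sigma> j \<in> carrier A" for j using xs c by (auto simp: \<sigma>_def)
  ultimately have "eval A \<sigma> (pterm n (Suc n) k ?d) = eval A \<sigma> (pterm n (Suc n) k (Var k))"
    by (rule satisfiesD)
  moreover have "map \<sigma> [0..<Suc n] = xs"
    by (rule nth_equalityI) (use xs in \<open>auto simp: \<sigma>_def simp del: upt_Suc\<close>)
  moreover have "\<sigma> (Suc n) = c" "\<sigma> k = xs ! k" using k by (simp_all add: \<sigma>_def)
  ultimately show ?thesis by (simp add: eval_pterm eval_dterm comp_def del: upt_Suc)
qed

lemma prj_prj: "k \<le> n \<Longrightarrow> x \<in> carrier A \<Longrightarrow> \<pi> k (\<pi> k x) = \<pi> k x"
  using prj_dd[of k "(replicate (Suc n) c)[k := x]"] prj_args[of x k]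
  by (simp add: prj_def[of n A c k x] del: replicate_Suc)

text \<open>In factor variety \<open>l\<close> the outer term picks its argument number
  \<open>l\<close>, which there is \<open>x\<close> itself.\<close>

lemma dd_prj:
  assumes x: "x \<in> carrier A"
  shows "dd n A (map (\<lambda>k. \<pi> k x) [0..<Suc n]) = x"
proof -
  define \<sigma> where "\<sigma> j = (if j = 0 then x else c)" for j :: nat
  let ?d = "dterm n (map (\<lambda>k. pterm n 1 k (Var 0)) [0..<Suc n])"
  have wf: "wf_trm (C_type m n) ?d" by (rule wf_dterm) (auto simp: wf_pterm)
  have "satisfies A (?d, Var 0)"
  proof (rule C_satisfies[OF n A wf], goal_cases)
    case (2 l B)
    show ?case
    proof (rule satisfiesI)
      fix \<sigma> :: "nat \<Rightarrow> 'a" assume s: "\<And>x. \<sigma> x \<in> carrier B"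
      have "eval B \<sigma> ?d = eval B \<sigma> (pterm n 1 l (Var 0))"
        using 2 s by (subst eval_dterm_factor) (auto simp: wf_pterm simp del: upt_Suc)
      then show "eval B \<sigma> ?d = eval B \<sigma> (Var 0)"
        using 2 s by (simp add: eval_pterm_factor[OF 2(2) 2(1)] del: upt_Suc)
    qed
  qed simp
  then have "eval A \<sigma> ?d = eval A \<sigma> (Var 0)"
    by (rule satisfiesD) (use x c in \<open>simp add: \<sigma>_def\<close>)
  then show ?thesis by (simp add: eval_pterm eval_dterm comp_def \<sigma>_def del: upt_Suc)
qed

text \<open>In factor variety \<open>k\<close> the projections outside and inside \<open>f\<close>
  act as the identity; in any other one both sides collapse to the base point.\<close>

lemma prj_opn:
  assumes k: "k \<le> n" and f: "C_type m n f = Some r" and xs: "length xs = r" "set xs \<subseteq> carrier A"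
  shows "\<pi> k (opn A f xs) = \<pi> k (opn A f (map (\<pi> k) xs))"
proof -
  \<comment> \<open>Variable \<open>r\<close> is the first that is not an argument of
    \<open>f\<close>; it carries the base point.\<close>
  define \<sigma> where "\<sigma> j = (if j < r then xs ! j else c)" for j
  let ?s = "App f (map Var [0..<r])" and ?t = "App f (map (\<lambda>i. pterm n r k (Var i)) [0..<r])"
  have wf: "wf_trm (C_type m n) ?s" "wf_trm (C_type m n) ?t" using f by (auto simp: wf_pterm)
  have "satisfies A (pterm n r k ?s, pterm n r k ?t)"
  proof (rule C_satisfies[OF n A wf_pterm[OF wf(1)] wf_pterm[OF wf(2)]], goal_cases)
    case (1 l B)
    show ?case
    proof (rule satisfiesI)
      fix \<sigma> :: "nat \<Rightarrow> 'a" assume s: "\<And>x. \<sigma> x \<in> carrier B"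
      show "eval B \<sigma> (pterm n r k ?s) = eval B \<sigma> (pterm n r k ?t)"
      proof (cases "k = l")
        case True
        have "eval B \<sigma> ?s = eval B \<sigma> ?t"
          using 1 s True by (simp add: comp_def eval_pterm_factor[OF 1(2) 1(1)] del: upt_Suc)
        then show ?thesis using s wf by (simp add: eval_pterm_factor[OF 1(2) 1(1)] del: eval.simps)
      next
        case False
        then show ?thesis using s wf by (simp add: eval_pterm_factor[OF 1(2) 1(1)] del: eval.simps)
      qed
    qed
  qed
  moreover have "\<sigma> j \<in> carrier A" for j using xs c by (auto simp: \<sigma>_def)
  ultimately have "eval A \<sigma> (pterm n r k ?s) = eval A \<sigma> (pterm n r k ?t)"
    by (rule satisfiesD)
  moreover have "map \<sigma> [0..<r] = xs" "map (\<lambda>i. \<pi> k (\<sigma> i)) [0..<r] = map (\<pi> k) xs"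
    by (auto intro!: nth_equalityI simp: \<sigma>_def xs)
  moreover have "\<sigma> r = c" by (simp add: \<sigma>_def)
  ultimately show ?thesis by (simp add: eval_pterm comp_def)
qed

lemma prj_inj:
  assumes "x \<in> carrier A" "y \<in> carrier A" "\<And>k. k \<le> n \<Longrightarrow> \<pi> k x = \<pi> k y"
  shows "x = y"
proof -
  have "map (\<lambda>k. \<pi> k x) [0..<Suc n] = map (\<lambda>k. \<pi> k y) [0..<Suc n]"
    using assms(3) by (auto simp del: upt_Suc)
  then show ?thesis using dd_prj assms(1,2) by metis
qed

lemma carrier_fac [simp]: "carrier (fac n A c k) = \<pi> k ` carrier A"
  by (simp add: fac_def)

lemma fac_subset: "carrier (fac n A c k) \<subseteq> carrier A"
  using prj_closed by auto

lemma hom_fac: "k \<le> n \<Longrightarrow> alg_hom (C_type m n) A (fac n A c k) (\<pi> k)"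
  unfolding alg_hom_def using prj_opn by (auto simp: fac_def)

lemma fac_algebra: "is_algebra (C_type m n) (fac n A c k)"
  unfolding is_algebra_def
proof (intro conjI allI impI)
  fix f r xs assume *: "C_type m n f = Some r \<and> length xs = r \<and> set xs \<subseteq> carrier (fac n A c k)"
  then have "opn A f xs \<in> carrier A" using subset_trans[OF _ fac_subset] by (intro is_algebraD[OF alg]) blast+
  then show "opn (fac n A c k) f xs \<in> carrier (fac n A c k)" by (simp add: fac_def)
qed (use c in auto)

text \<open>An identity of factor variety \<open>k\<close>, wrapped into \<open>pterm n v k\<close>,
  holds in every factor variety, since for another index both sides are \<open>v\<close>. So it
  holds in \<open>A\<close>, where it is the original identity evaluated in
  \<open>fac\<close>.\<close>

lemma fac_factor_var:
  assumes k: "k \<le> n"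
  shows "fac n A c k \<in> factor_var m n k"
proof (rule factor_var_closed[OF m n k fac_algebra])
  fix s t assume wf: "wf_trm (C_type m n) s" "wf_trm (C_type m n) t"
    and sat: "\<And>B :: (symb, 'a) alg. B \<in> factor_var m n k \<Longrightarrow> satisfies B (s, t)"
  have "finite (vars s \<union> vars t)" by (simp add: finite_vars)
  \<comment> \<open>A fresh variable can be sent to \<open>c\<close> without disturbing
    \<open>s\<close> and \<open>t\<close>.\<close>
  then obtain v where v: "v \<notin> vars s \<union> vars t" using ex_new_if_finite[OF infinite_UNIV_nat] by blast
  have A_sat: "satisfies A (pterm n v k s, pterm n v k t)"
  proof (rule C_satisfies[OF n A wf_pterm[OF wf(1)] wf_pterm[OF wf(2)]])
    fix l and B :: "(symb, 'a) alg" assume B: "l \<le> n" "B \<in> factor_var m n l"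
    show "satisfies B (pterm n v k s, pterm n v k t)"
      using eval_pterm_factor[OF B(2,1) wf(1)] eval_pterm_factor[OF B(2,1) wf(2)] satisfiesD[OF sat] B
      by (intro satisfiesI) auto
  qed
  show "satisfies (fac n A c k) (s, t)"
  proof (rule satisfiesI)
    fix \<sigma> :: "nat \<Rightarrow> 'a" assume s: "\<And>x. \<sigma> x \<in> carrier (fac n A c k)"
    have \<sigma>: "\<sigma> x \<in> carrier A" "\<pi> k (\<sigma> x) = \<sigma> x" for x
      using s[of x] prj_closed prj_prj[OF k] by auto
    have 1: "eval (fac n A c k) \<sigma> u = \<pi> k (eval A \<sigma> u)" if "wf_trm (C_type m n) u" for u
      using eval_alg_hom[OF alg hom_fac[OF k] that, of \<sigma>] \<sigma> by simp
    have "eval A (\<sigma>(v := c)) (pterm n v k s) = eval A (\<sigma>(v := c)) (pterm n v k t)"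
      by (rule satisfiesD[OF A_sat]) (use \<sigma> c in auto)
    moreover have "eval A (\<sigma>(v := c)) s = eval A \<sigma> s" "eval A (\<sigma>(v := c)) t = eval A \<sigma> t"
      using v by (auto intro!: eval_cong_vars)
    ultimately show "eval (fac n A c k) \<sigma> s = eval (fac n A c k) \<sigma> t"
      by (simp add: 1 wf eval_pterm)
  qed
qed

end

text \<open>The factors \<open>Q k\<close> share the carrier type of \<open>A\<close> because
  \<open>C_I\<close> consults only that type. For a quotient algebra this is met by the quotients of
  its factors.\<close>

lemma C_subdirect:
  assumes n: "1 \<le> n" and alg: "is_algebra (C_type m n) A"
    and hom: "\<And>k. k \<le> n \<Longrightarrow> alg_hom (C_type m n) A (Q k) (h k)"
    and inj: "\<And>x y. x \<in> carrier A \<Longrightarrow> y \<in> carrier A \<Longrightarrow> (\<And>k. k \<le> n \<Longrightarrow> h k x = h k y) \<Longrightarrow> x = y"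
    and Q: "\<And>k. k \<le> n \<Longrightarrow> (Q k :: (symb, 'a) alg) \<in> factor_var m n k"
  shows "(A :: (symb, 'a) alg) \<in> C m n"
proof (rule C_I[OF n alg])
  fix s t assume wf: "wf_trm (C_type m n) s" "wf_trm (C_type m n) t"
    and sat: "\<And>k B. k \<le> n \<Longrightarrow> (B :: (symb, 'a) alg) \<in> factor_var m n k \<Longrightarrow> satisfies B (s, t)"
  show "satisfies A (s, t)"
    by (rule satisfies_subdirect[OF alg wf, of "{..n}" Q h]) (use assms sat in auto)
qed

section \<open>Blocks\<close>

lemma BlockD: "B \<in> Block A T \<Longrightarrow> B \<subseteq> carrier A" "B \<in> Block A T \<Longrightarrow> B \<times> B \<subseteq> T"
  by (auto simp: Block_def)

lemma Block_maximal:
  "B \<in> Block A T \<Longrightarrow> B' \<subseteq> carrier A \<Longrightarrow> B' \<times> B' \<subseteq> T \<Longrightarrow> B \<subseteq> B' \<Longrightarrow> B' = B"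
  by (auto simp: Block_def)

lemma Block_subset_eq: "B \<in> Block A T \<Longrightarrow> D \<in> Block A T \<Longrightarrow> B \<subseteq> D \<Longrightarrow> D = B"
  using Block_maximal[of B A T D] BlockD[of D A T] by simp

lemma Block_memI:
  assumes "B \<in> Block A T" "sym T" "refl_on (carrier A) T" "x \<in> carrier A" "\<And>b. b \<in> B \<Longrightarrow> (b, x) \<in> T"
  shows "x \<in> B"
proof -
  have "insert x B \<times> insert x B \<subseteq> T"
    using assms BlockD(2)[OF assms(1)] by (auto simp: refl_on_def dest: symD)
  then have "insert x B = B"
    using assms BlockD(1)[OF assms(1)] by (intro Block_maximal[OF assms(1)]) auto
  then show ?thesis by blast
qed

lemma Block_eqI:
  assumes "B \<in> Block A T" "D \<in> Block A T" "sym T" "refl_on (carrier A) T"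
    "\<And>b d. b \<in> B \<Longrightarrow> d \<in> D \<Longrightarrow> (b, d) \<in> T"
  shows "B = D"
proof -
  have "D \<subseteq> B" using assms BlockD(1)[OF assms(2)] by (blast intro: Block_memI[OF assms(1,3,4)])
  then show ?thesis using Block_subset_eq assms by blast
qed

lemma Block_nonempty:
  assumes "B \<in> Block A T" "sym T" "refl_on (carrier A) T" "carrier A \<noteq> {}"
  shows "B \<noteq> {}"
  using Block_memI[OF assms(1-3)] assms(4) by fastforce

lemma Block_exists:
  assumes "D \<subseteq> carrier A" "D \<times> D \<subseteq> T"
  shows "\<exists>B\<in>Block A T. D \<subseteq> B"
proof -
  let ?X = "{B. D \<subseteq> B \<and> B \<subseteq> carrier A \<and> B \<times> B \<subseteq> T}"
  have "\<exists>M\<in>?X. \<forall>X\<in>?X. M \<subseteq> X \<longrightarrow> X = M"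
  proof (rule subset_Zorn_nonempty)
    show "?X \<noteq> {}" using assms by blast
    fix K assume K: "K \<noteq> {}" "subset.chain ?X K"
    have sub: "D \<subseteq> B" "B \<subseteq> carrier A" "B \<times> B \<subseteq> T" if "B \<in> K" for B
    proof -
      have "B \<in> ?X" using K(2) that unfolding subset_chain_def by (elim conjE) (rule subsetD)
      then show "D \<subseteq> B" "B \<subseteq> carrier A" "B \<times> B \<subseteq> T" by simp_all
    qed
    have lin: "B \<subseteq> E \<or> E \<subseteq> B" if "B \<in> K" "E \<in> K" for B E
      using K(2) that unfolding subset_chain_def by simp
    have "(x, y) \<in> T" if "B \<in> K" "E \<in> K" "x \<in> B" "y \<in> E" for x y B E
      using lin[OF that(1,2)] sub(3)[OF that(1)] sub(3)[OF that(2)] that(3,4) by blast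
    then have "\<Union> K \<times> \<Union> K \<subseteq> T" by auto
    moreover have "D \<subseteq> \<Union> K" "\<Union> K \<subseteq> carrier A" using sub(1,2) K(1) by blast+
    ultimately show "\<Union> K \<in> ?X" by blast
  qed
  then obtain M where M: "M \<in> ?X" "\<forall>X\<in>?X. M \<subseteq> X \<longrightarrow> X = M" by (elim bexE)
  have "M \<in> Block A T" unfolding Block_def
  proof (intro CollectI conjI allI impI; (elim conjE)?)
    fix X assume X: "X \<subseteq> carrier A" "X \<times> X \<subseteq> T" "M \<subseteq> X"
    then have "X \<in> ?X" using M(1) by auto
    then show "X = M" using M(2) X(3) by simp
  qed (use M(1) in auto)
  then show ?thesis using M(1) by auto
qed

lemma set_op_closed:
  assumes "is_algebra \<tau> A" "\<tau> f = Some r" "length Bs = r" "set Bs \<subseteq> Block A T"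
  shows "set_op A f Bs \<subseteq> carrier A"
proof -
  have "opn A f bs \<in> carrier A" if "list_all2 (\<lambda>b B. b \<in> B) bs Bs" for bs
  proof (rule is_algebraD[OF assms(1,2)])
    show "length bs = r" using that assms by (simp add: list_all2_lengthD)
    have "bs ! i \<in> carrier A" if i: "i < length bs" for i
    proof -
      have "Bs ! i \<in> Block A T" "bs ! i \<in> Bs ! i"
        using \<open>list_all2 _ bs Bs\<close> i assms(4) by (auto simp: list_all2_conv_all_nth)
      then show ?thesis using BlockD(1) by blast
    qed
    then show "set bs \<subseteq> carrier A" by (auto simp: in_set_conv_nth)
  qed
  then show ?thesis by (auto simp: set_op_def)
qed

lemma set_op_connected:
  assumes "compatible \<tau> A T" "\<tau> f = Some r" "length Bs = r" "set Bs \<subseteq> Block A T"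
  shows "set_op A f Bs \<times> set_op A f Bs \<subseteq> T"
proof -
  have "(opn A f bs, opn A f cs) \<in> T"
    if bs: "list_all2 (\<lambda>b B. b \<in> B) bs Bs" "list_all2 (\<lambda>b B. b \<in> B) cs Bs" for bs cs
  proof -
    have "(bs ! i, cs ! i) \<in> T" if i: "i < length bs" for i
    proof -
      have "Bs ! i \<in> Block A T" "bs ! i \<in> Bs ! i" "cs ! i \<in> Bs ! i"
        using bs i assms(4) by (auto simp: list_all2_conv_all_nth)
      then show ?thesis using BlockD(2) by blast
    qed
    then have "list_all2 (\<lambda>x y. (x, y) \<in> T) bs cs" using bs by (auto simp: list_all2_conv_all_nth)
    moreover have "length bs = r" "length cs = r" using bs assms(3) by (auto dest: list_all2_lengthD)
    ultimately show ?thesis using assms(1,2) by (auto simp: compatible_def)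
  qed
  then show ?thesis by (auto simp: set_op_def)
qed

lemma factorableI:
  fixes A :: "('f, 'a) alg"
  assumes "is_algebra \<tau> A" "tolerance \<tau> A T"
    and "\<And>f r Bs E E'. \<tau> f = Some r \<Longrightarrow> length Bs = r \<Longrightarrow> set Bs \<subseteq> Block A T \<Longrightarrow>
      E \<in> Block A T \<Longrightarrow> set_op A f Bs \<subseteq> E \<Longrightarrow> E' \<in> Block A T \<Longrightarrow> set_op A f Bs \<subseteq> E' \<Longrightarrow> E = E'"
  shows "factorable \<tau> A T"
  unfolding factorable_def
proof (intro allI impI, elim conjE)
  fix f r and Bs :: "'a set list" assume f: "\<tau> f = Some r" "length Bs = r" "set Bs \<subseteq> Block A T"
  have "compatible \<tau> A T" using assms(2) by (simp add: tolerance_def)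
  then obtain E where "E \<in> Block A T" "set_op A f Bs \<subseteq> E"
    using Block_exists[OF set_op_closed[OF assms(1) f]] set_op_connected[of \<tau> A T, OF _ f] by blast
  then show "\<exists>!B. B \<in> Block A T \<and> set_op A f Bs \<subseteq> B"
    using assms(3)[OF f] by blast
qed

lemma quotient_opn:
  assumes "factorable \<tau> A T" "\<tau> f = Some r" "length Bs = r" "set Bs \<subseteq> Block A T"
  shows "opn (quotient_alg A T) f Bs \<in> Block A T" "set_op A f Bs \<subseteq> opn (quotient_alg A T) f Bs"
    and "E \<in> Block A T \<Longrightarrow> set_op A f Bs \<subseteq> E \<Longrightarrow> opn (quotient_alg A T) f Bs = E"
proof -
  have ex: "\<exists>!B. B \<in> Block A T \<and> set_op A f Bs \<subseteq> B"
    using assms(1)[unfolded factorable_def, rule_format, of f r Bs] assms(2-4) by simp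
  have q: "opn (quotient_alg A T) f Bs = (THE B. B \<in> Block A T \<and> set_op A f Bs \<subseteq> B)"
    by (simp add: quotient_alg_def)
  show "opn (quotient_alg A T) f Bs \<in> Block A T" "set_op A f Bs \<subseteq> opn (quotient_alg A T) f Bs"
    unfolding q by (rule theI'[OF ex, THEN conjunct1] theI'[OF ex, THEN conjunct2])+
  show "E \<in> Block A T \<Longrightarrow> set_op A f Bs \<subseteq> E \<Longrightarrow> opn (quotient_alg A T) f Bs = E"
    unfolding q by (rule the1_equality[OF ex]) (rule conjI)
qed

lemma carrier_quotient [simp]: "carrier (quotient_alg A T) = Block A T"
  by (simp add: quotient_alg_def)

lemma toleranceD:
  assumes "tolerance \<tau> A T"
  shows "T \<subseteq> carrier A \<times> carrier A" "refl_on (carrier A) T" "sym T" "compatible \<tau> A T"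
  using assms by (auto simp: tolerance_def)

lemma quotient_algebra:
  assumes "is_algebra \<tau> A" "factorable \<tau> A T"
  shows "is_algebra \<tau> (quotient_alg A T)"
  using Block_exists[of "{}" A T] quotient_opn(1)[OF assms(2)] by (auto simp: is_algebra_def)

text \<open>Every element of the selected block is a value of \<open>f\<close>: the other arguments
  are filled arbitrarily, blocks being nonempty. So that block lies inside \<open>E\<close>, and a
  block inside a block equals it.\<close>

lemma proj_block_unique:
  assumes "is_algebra \<tau> A" "tolerance \<tau> A T" "acts_as_proj A f r i" "1 \<le> i" "i \<le> r"
    "length Bs = r" "set Bs \<subseteq> Block A T" "E \<in> Block A T" "set_op A f Bs \<subseteq> E"
  shows "E = Bs ! (i - 1)"
proof -
  let ?B = "Bs ! (i - 1)"
  have B: "?B \<in> Block A T" using assms by auto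
  have ne: "B \<noteq> {}" if "B \<in> set Bs" for B
    using Block_nonempty[OF _ toleranceD(3,2)[OF assms(2)]] assms(1,7) that by (auto simp: is_algebra_def)
  have "b \<in> E" if b: "b \<in> ?B" for b
  proof -
    define bs where "bs = (map (\<lambda>B. SOME b. b \<in> B) Bs)[i - 1 := b]"
    have all: "list_all2 (\<lambda>b B. b \<in> B) bs Bs"
      unfolding list_all2_conv_all_nth
    proof (intro conjI allI impI)
      fix l assume l: "l < length bs"
      then have "(SOME b. b \<in> Bs ! l) \<in> Bs ! l" using ne[of "Bs ! l"] by (simp add: bs_def some_in_eq)
      then show "bs ! l \<in> Bs ! l" using b l assms(4-6) by (auto simp: bs_def nth_list_update)
    qed (simp add: bs_def)
    have "bs ! l \<in> carrier A" if "l < length bs" for l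
    proof -
      have "bs ! l \<in> Bs ! l" "Bs ! l \<in> Block A T"
        using all that assms(7) by (auto simp: list_all2_conv_all_nth)
      then show ?thesis using BlockD(1) by blast
    qed
    then have "set bs \<subseteq> carrier A" by (auto simp: in_set_conv_nth)
    then have "opn A f bs = b"
      using acts_as_projD[OF assms(3), of bs] assms(4-6) by (simp add: bs_def)
    then show ?thesis using all assms(9) by (auto simp: set_op_def)
  qed
  then show ?thesis using Block_subset_eq[OF B assms(8)] by blast
qed

lemma proj_quotient:
  assumes "is_algebra \<tau> A" "tolerance \<tau> A T" "factorable \<tau> A T" "acts_as_proj A f r i" "1 \<le> i" "i \<le> r"
    "\<tau> f = Some r"
  shows "acts_as_proj (quotient_alg A T) f r i"
  unfolding acts_as_proj_def
  by (intro allI impI proj_block_unique[OF assms(1,2,4-6)] quotient_opn(1,2)[OF assms(3,7)]) auto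

section \<open>Tolerances of lattices\<close>

text \<open>Stated for two functions instead of the symbols, so that exchanging \<open>j\<close> and
  \<open>k\<close> gives the dual lattice. The algebra \<open>A\<close> enters only through
  \<open>Block\<close>.\<close>

locale tol_lattice =
  fixes L :: "'a set" and j k :: "'a \<Rightarrow> 'a \<Rightarrow> 'a" and T :: "('a \<times> 'a) set" and A :: "('f, 'a) alg"
  assumes L: "carrier A = L" and ne: "L \<noteq> {}"
    and jc: "x \<in> L \<Longrightarrow> y \<in> L \<Longrightarrow> j x y \<in> L" and kc: "x \<in> L \<Longrightarrow> y \<in> L \<Longrightarrow> k x y \<in> L"
    and jcomm: "x \<in> L \<Longrightarrow> y \<in> L \<Longrightarrow> j x y = j y x" and kcomm: "x \<in> L \<Longrightarrow> y \<in> L \<Longrightarrow> k x y = k y x"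
    and jass: "x \<in> L \<Longrightarrow> y \<in> L \<Longrightarrow> z \<in> L \<Longrightarrow> j (j x y) z = j x (j y z)"
    and kass: "x \<in> L \<Longrightarrow> y \<in> L \<Longrightarrow> z \<in> L \<Longrightarrow> k (k x y) z = k x (k y z)"
    and jk: "x \<in> L \<Longrightarrow> y \<in> L \<Longrightarrow> j x (k x y) = x" and kj: "x \<in> L \<Longrightarrow> y \<in> L \<Longrightarrow> k x (j x y) = x"
    and TL: "T \<subseteq> L \<times> L" and reflT: "refl_on L T" and symT: "sym T"
    and jT: "(x, y) \<in> T \<Longrightarrow> (u, v) \<in> T \<Longrightarrow> (j x u, j y v) \<in> T"
    and kT: "(x, y) \<in> T \<Longrightarrow> (u, v) \<in> T \<Longrightarrow> (k x u, k y v) \<in> T"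
begin

lemma dual: "tol_lattice L k j T A"
  by unfold_locales (rule L ne jc kc jcomm kcomm jass kass jk kj TL reflT symT jT kT; assumption)+

lemma kk: "x \<in> L \<Longrightarrow> k x x = x"
  using kj[of x "k x x"] jk[of x x] kc[of x x] by simp

lemma le_iff: "x \<in> L \<Longrightarrow> y \<in> L \<Longrightarrow> j x y = y \<longleftrightarrow> k x y = x"
  using kj[of x y] jk[of y x] jcomm[of x y] kcomm[of x y] by auto

lemma le_trans: "x \<in> L \<Longrightarrow> y \<in> L \<Longrightarrow> z \<in> L \<Longrightarrow> j x y = y \<Longrightarrow> j y z = z \<Longrightarrow> j x z = z"
  using jass[of x y z] by simp

text \<open>Joining the pair \<open>(u, v)\<close> with \<open>x\<close> and with \<open>y\<close>
  relates both to \<open>v\<close>. Meeting these pairs with \<open>y\<close> and \<open>x\<close>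
  relates both to \<open>k x y\<close>, and joining the two resulting pairs relates \<open>x\<close>
  to \<open>y\<close>.\<close>

lemma convex:
  assumes "(u, v) \<in> T" "x \<in> L" "y \<in> L" "j u x = x" "j x v = v" "j u y = y" "j y v = v"
  shows "(x, y) \<in> T"
proof -
  have uv: "u \<in> L" "v \<in> L" using assms(1) TL by auto
  have r: "(x, x) \<in> T" "(y, y) \<in> T" using reflT assms(2,3) by (auto simp: refl_on_def)
  have "(x, v) \<in> T" "(y, v) \<in> T"
    using jT[OF assms(1) r(1)] jT[OF assms(1) r(2)] assms uv by (simp_all add: jcomm)
  from kT[OF this(1) r(2)] kT[OF this(2) r(1)]
  have "(k x y, y) \<in> T" "(k y x, x) \<in> T"
    using assms uv le_iff kcomm[of v x] kcomm[of v y] by auto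
  then have "(x, k x y) \<in> T" "(k x y, y) \<in> T" using symT assms kcomm[of x y] by (auto dest: symD)
  from jT[OF this] show ?thesis
    using assms jk[of x y] jk[of y x] kcomm[of x y] jcomm[of y "k x y"] kc by simp
qed

text \<open>Stands in for the least element, which a block of an infinite lattice may lack.\<close>

definition up :: "'a set \<Rightarrow> 'a set" where
  "up B = {z \<in> L. \<exists>b\<in>B. j b z = z}"

lemma block_mem: "B \<in> Block A T \<Longrightarrow> x \<in> L \<Longrightarrow> (\<And>b. b \<in> B \<Longrightarrow> (b, x) \<in> T) \<Longrightarrow> x \<in> B"
  using Block_memI[OF _ symT] reflT L by blast

lemma block_sub: "B \<in> Block A T \<Longrightarrow> b \<in> B \<Longrightarrow> b \<in> L"
  using BlockD(1) L by blast

lemma block_T: "B \<in> Block A T \<Longrightarrow> b \<in> B \<Longrightarrow> b' \<in> B \<Longrightarrow> (b, b') \<in> T"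
  using BlockD(2) by blast

lemma block_ne: "B \<in> Block A T \<Longrightarrow> \<exists>b. b \<in> B"
  using Block_nonempty[OF _ symT] reflT ne L by blast

lemma block_k:
  assumes "B \<in> Block A T" "b \<in> B" "b' \<in> B"
  shows "k b b' \<in> B"
proof (rule block_mem[OF assms(1)])
  fix x assume x: "x \<in> B"
  show "(x, k b b') \<in> T"
    using kT[OF block_T[OF assms(1) x assms(2)] block_T[OF assms(1) x assms(3)]] kk block_sub[OF assms(1) x] by simp
qed (use kc block_sub assms in auto)

lemma k_le: "x \<in> L \<Longrightarrow> y \<in> L \<Longrightarrow> j (k x y) x = x" "x \<in> L \<Longrightarrow> y \<in> L \<Longrightarrow> j (k x y) y = y"
  using jk[of x y] jk[of y x] kcomm[of x y] jcomm[of "k x y"] kc by auto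

lemma j_ge: "x \<in> L \<Longrightarrow> y \<in> L \<Longrightarrow> j x (j x y) = j x y" "x \<in> L \<Longrightarrow> y \<in> L \<Longrightarrow> j y (j x y) = j x y"
  using jcomm[of x y] kj[of x y] kj[of y x] le_iff jc by auto

text \<open>For \<open>b\<close> in \<open>B\<close> and \<open>d\<close> in \<open>D\<close> the
  equal up-sets yield a descending chain \<open>b1\<close>, \<open>d1\<close>, \<open>b2\<close>,
  alternating between the blocks and starting below both \<open>b\<close> and \<open>d\<close>.
  Joining the pairs \<open>(b2, b)\<close> and \<open>(d1, d)\<close> relates \<open>d1\<close> to
  \<open>j b d\<close>; the interval between these contains \<open>b\<close> and \<open>d\<close>,
  so convexity applies.\<close>

lemma up_inj:
  assumes B: "B \<in> Block A T" and D: "D \<in> Block A T" and up: "up B = up D"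
  shows "B = D"
proof (rule Block_eqI[OF B D symT])
  show "refl_on (carrier A) T" using reflT L by simp
  fix b d assume b: "b \<in> B" and d: "d \<in> D"
  note sub = block_sub[OF B] block_sub[OF D]
  have upE: "\<exists>x\<in>X. j x z = z" if "z \<in> up X" for X z using that by (auto simp: up_def)
  have self: "x \<in> up X" if "x \<in> X" "x \<in> L" for x X
    using that kk[OF that(2)] le_iff[of x x] by (auto simp: up_def)
  obtain b' where b': "b' \<in> B" "j b' d = d" using upE[of d B] self[OF d] sub d up by auto
  define b1 where "b1 = k b' b"
  have b1: "b1 \<in> B" unfolding b1_def by (rule block_k[OF B b'(1) b])
  have b1_le: "j b1 b = b" "j b1 d = d"
    using k_le[of b' b] le_trans[of b1 b' d] sub b b' d b1 by (auto simp: b1_def)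
  obtain d1 where d1: "d1 \<in> D" "j d1 b1 = b1" using upE[of b1 D] self[OF b1] sub b1 up by auto
  obtain b2 where b2: "b2 \<in> B" "j b2 d1 = d1" using upE[of d1 B] self[OF d1(1)] sub d1 up by auto
  have "j d1 b = b" "j d1 d = d"
    using le_trans[of d1 b1 b] le_trans[of d1 b1 d] sub d1 b1 b1_le b d by auto
  moreover have "(d1, j b d) \<in> T"
    using jT[OF block_T[OF B b2(1) b] block_T[OF D d1(1) d]] b2 by simp
  ultimately show "(b, d) \<in> T"
    using convex[of d1 "j b d" b d] j_ge sub b d by auto
qed

text \<open>If \<open>e\<close> is in \<open>E\<close> and \<open>b\<close> in \<open>B\<close>,
  then \<open>k b e\<close> is in \<open>B\<close>: by absorption any \<open>b'\<close> in
  \<open>B\<close> is the meet of \<open>b'\<close> with \<open>j b' d\<close>, and the latter is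
  related to \<open>e\<close> inside \<open>E\<close>. So each bound of \<open>E\<close> from above
  lies above an element of \<open>B\<close>. The other inclusion takes the join of elements of
  \<open>B\<close> and \<open>D\<close> below \<open>z\<close>.\<close>

lemma up_join:
  assumes B: "B \<in> Block A T" and D: "D \<in> Block A T" and E: "E \<in> Block A T"
    and sub: "\<And>b d. b \<in> B \<Longrightarrow> d \<in> D \<Longrightarrow> j b d \<in> E"
  shows "up E = up B \<inter> up D"
proof
  have *: "up E \<subseteq> up B"
    if B: "B \<in> Block A T" and D: "D \<in> Block A T" and sub: "\<And>b d. b \<in> B \<Longrightarrow> d \<in> D \<Longrightarrow> j b d \<in> E"
    for B D
  proof
    fix z assume "z \<in> up E"
    then obtain e where e: "e \<in> E" "z \<in> L" "j e z = z" by (auto simp: up_def)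
    obtain b d where b: "b \<in> B" and d: "d \<in> D" using block_ne B D by blast
    note m = block_sub[OF B] block_sub[OF D] block_sub[OF E]
    have "k b e \<in> B"
    proof (rule block_mem[OF B])
      fix b' assume b': "b' \<in> B"
      have "(k b' (j b' d), k b e) \<in> T"
        by (rule kT[OF block_T[OF B b' b] block_T[OF E sub[OF b' d] e(1)]])
      then show "(b', k b e) \<in> T" using kj m b' d by simp
    qed (use m b e kc in auto)
    moreover have "j (k b e) z = z" using le_trans[of "k b e" e z] k_le(2)[of b e] m b e kc by auto
    ultimately show "z \<in> up B" using e by (auto simp: up_def)
  qed
  have "up E \<subseteq> up D"
    by (rule *[OF D B]) (subst jcomm, auto intro: sub block_sub[OF B] block_sub[OF D])
  then show "up E \<subseteq> up B \<inter> up D" using *[OF B D sub] by blast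
  show "up B \<inter> up D \<subseteq> up E"
  proof
    fix z assume "z \<in> up B \<inter> up D"
    then obtain b d where z: "z \<in> L" "b \<in> B" "d \<in> D" "j b z = z" "j d z = z" by (auto simp: up_def)
    have "j (j b d) z = z" using z jass[of b d z] block_sub B D by auto
    then show "z \<in> up E" using sub z by (auto simp: up_def)
  qed
qed

lemma join_unique:
  assumes "B \<in> Block A T" "D \<in> Block A T" "E \<in> Block A T" "E' \<in> Block A T"
    and "\<And>b d. b \<in> B \<Longrightarrow> d \<in> D \<Longrightarrow> j b d \<in> E" "\<And>b d. b \<in> B \<Longrightarrow> d \<in> D \<Longrightarrow> j b d \<in> E'"
  shows "E = E'"
  using up_inj[OF assms(3,4)] up_join[OF assms(1-3)] up_join[OF assms(1,2,4)] assms(5,6) by simp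

lemma join_assoc:
  assumes "B \<in> Block A T" "D \<in> Block A T" "E \<in> Block A T"
    and "BD \<in> Block A T" "\<And>b d. b \<in> B \<Longrightarrow> d \<in> D \<Longrightarrow> j b d \<in> BD"
    and "DE \<in> Block A T" "\<And>b d. b \<in> D \<Longrightarrow> d \<in> E \<Longrightarrow> j b d \<in> DE"
    and "X \<in> Block A T" "\<And>b d. b \<in> BD \<Longrightarrow> d \<in> E \<Longrightarrow> j b d \<in> X"
    and "Y \<in> Block A T" "\<And>b d. b \<in> B \<Longrightarrow> d \<in> DE \<Longrightarrow> j b d \<in> Y"
  shows "X = Y"
  by (rule up_inj[OF assms(8,10)])
    (simp add: up_join[OF assms(4,3,8,9)] up_join[OF assms(1,2,4,5)] up_join[OF assms(2,3,6,7)]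
      up_join[OF assms(1,6,10,11)] Int_assoc)

text \<open>Meets with elements of \<open>D\<close> only go down, so the up-set of \<open>B\<close>
  lies in that of \<open>M\<close>, and intersecting the two returns the former.\<close>

lemma join_absorb:
  assumes "B \<in> Block A T" "D \<in> Block A T"
    and "M \<in> Block A T" "\<And>b d. b \<in> B \<Longrightarrow> d \<in> D \<Longrightarrow> k b d \<in> M"
    and "X \<in> Block A T" "\<And>b d. b \<in> B \<Longrightarrow> d \<in> M \<Longrightarrow> j b d \<in> X"
  shows "X = B"
proof (rule up_inj[OF assms(5,1)])
  obtain d where d: "d \<in> D" using block_ne assms(2) by blast
  have "up B \<subseteq> up M"
  proof
    fix z assume "z \<in> up B"
    then obtain b where b: "b \<in> B" "z \<in> L" "j b z = z" by (auto simp: up_def)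
    have "j (k b d) z = z"
      using le_trans[of "k b d" b z] k_le(1)[of b d] block_sub assms(1,2) b d kc by auto
    then show "z \<in> up M" using assms(4)[OF b(1) d] b by (auto simp: up_def)
  qed
  then show "up X = up B" using up_join[OF assms(1,3,5,6)] by auto
qed

end

section \<open>Block operations of small arity\<close>

lemma set_op_subset:
  "set_op A f Bs \<subseteq> E \<longleftrightarrow> (\<forall>bs. list_all2 (\<lambda>b B. b \<in> B) bs Bs \<longrightarrow> opn A f bs \<in> E)"
proof -
  have "set_op A f Bs = opn A f ` {bs. list_all2 (\<lambda>b B. b \<in> B) bs Bs}"
    by (simp only: set_op_def setcompr_eq_image)
  then show ?thesis by (simp only: image_subset_iff Ball_def mem_Collect_eq)
qed

lemma set_op_binary:
  "set_op A f [B, D] \<subseteq> E \<longleftrightarrow> (\<forall>b\<in>B. \<forall>d\<in>D. opn A f [b, d] \<in> E)"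
proof -
  have "list_all2 (\<lambda>b B. b \<in> B) bs [B, D] \<longleftrightarrow> (\<exists>b\<in>B. \<exists>d\<in>D. bs = [b, d])" for bs
    by (auto simp: list_all2_Cons2)
  then show ?thesis by (simp only: set_op_subset) blast
qed

lemma set_op_unary: "set_op A f [B] \<subseteq> E \<longleftrightarrow> (\<forall>b\<in>B. opn A f [b] \<in> E)"
proof -
  have "list_all2 (\<lambda>b B. b \<in> B) bs [B] \<longleftrightarrow> (\<exists>b\<in>B. bs = [b])" for bs
    by (auto simp: list_all2_Cons2)
  then show ?thesis by (simp only: set_op_subset) blast
qed

lemma quotient_binary:
  assumes "factorable \<tau> A T" "\<tau> f = Some 2" "B \<in> Block A T" "D \<in> Block A T"
  shows "opn (quotient_alg A T) f [B, D] \<in> Block A T"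
    and "b \<in> B \<Longrightarrow> d \<in> D \<Longrightarrow> opn A f [b, d] \<in> opn (quotient_alg A T) f [B, D]"
    and "E \<in> Block A T \<Longrightarrow> (\<And>b d. b \<in> B \<Longrightarrow> d \<in> D \<Longrightarrow> opn A f [b, d] \<in> E) \<Longrightarrow>
      opn (quotient_alg A T) f [B, D] = E"
proof -
  have l: "length [B, D] = 2" "set [B, D] \<subseteq> Block A T" using assms by simp_all
  note q = quotient_opn[OF assms(1,2) l, unfolded set_op_binary]
  show "opn (quotient_alg A T) f [B, D] \<in> Block A T" by (rule q(1))
  show "b \<in> B \<Longrightarrow> d \<in> D \<Longrightarrow> opn A f [b, d] \<in> opn (quotient_alg A T) f [B, D]"
    using q(2) by simp
  show "E \<in> Block A T \<Longrightarrow> (\<And>b d. b \<in> B \<Longrightarrow> d \<in> D \<Longrightarrow> opn A f [b, d] \<in> E) \<Longrightarrow>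
      opn (quotient_alg A T) f [B, D] = E"
    by (rule q(3)) simp_all
qed

lemma length_2: "length xs = 2 \<longleftrightarrow> (\<exists>x y. xs = [x, y])"
  by (auto simp: numeral_2_eq_2 length_Suc_conv)

lemma compatibleD:
  "compatible \<tau> A T \<Longrightarrow> \<tau> f = Some (length xs) \<Longrightarrow> list_all2 (\<lambda>x y. (x, y) \<in> T) xs ys \<Longrightarrow>
    (opn A f xs, opn A f ys) \<in> T"
  unfolding compatible_def using list_all2_lengthD by metis

lemma list_all2_subset:
  assumes "R \<subseteq> X \<times> Y" "list_all2 (\<lambda>x y. (x, y) \<in> R) xs ys"
  shows "set xs \<subseteq> X" "set ys \<subseteq> Y"
  using assms(2) by (induction rule: list_all2_induct) (use assms(1) in auto)

lemma compatible_binary: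
  assumes "compatible \<tau> A T" "\<tau> f = Some 2" "(x, y) \<in> T" "(u, v) \<in> T"
  shows "(opn A f [x, u], opn A f [y, v]) \<in> T"
  by (rule compatibleD[OF assms(1)]) (use assms in simp_all)

lemma compatible_unary:
  assumes "compatible \<tau> A T" "\<tau> f = Some 1" "(x, y) \<in> T"
  shows "(opn A f [x], opn A f [y]) \<in> T"
  by (rule compatibleD[OF assms(1)]) (use assms in simp_all)

lemma RLat_tol_lattice:
  assumes A: "A \<in> RLat_ext m n" and T: "tolerance (C_type m n) A T"
  shows "tol_lattice (carrier A) (\<lambda>x y. opn A Join [x, y]) (\<lambda>x y. opn A Meet [x, y]) T A"
proof
  note compat = toleranceD(4)[OF T]
  show "carrier A \<noteq> {}" using RLat_extD(15)[OF A] by (auto simp: is_algebra_def)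
  show "T \<subseteq> carrier A \<times> carrier A" "refl_on (carrier A) T" "sym T" by (rule toleranceD[OF T])+
  fix x y u v assume "(x, y) \<in> T" "(u, v) \<in> T"
  then show "(opn A Join [x, u], opn A Join [y, v]) \<in> T" "(opn A Meet [x, u], opn A Meet [y, v]) \<in> T"
    using compatible_binary[OF compat] by auto
qed (rule refl RLat_extD[OF A]; assumption)+

text \<open>The inverse of \<open>g\<close> is a power of \<open>g\<close> and so preserves
  \<open>T\<close> as well. It carries \<open>E\<close> to a set with all pairs in \<open>T\<close>
  that contains \<open>B\<close>, and this is \<open>B\<close> by maximality.\<close>

lemma aut_block_unique:
  assumes cl: "\<And>x. x \<in> carrier A \<Longrightarrow> g x \<in> carrier A" and fin: "\<And>x. x \<in> carrier A \<Longrightarrow> (g ^^ r) x = x" and r: "1 \<le> r"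
    and T: "\<And>x y. (x, y) \<in> T \<Longrightarrow> (g x, g y) \<in> T"
    and B: "B \<in> Block A T" and E: "E \<in> Block A T" and sub: "g ` B \<subseteq> E"
  shows "E = g ` B"
proof -
  have clp: "(g ^^ i) x \<in> carrier A" if "x \<in> carrier A" for i x
    using that cl by (induction i) auto
  have Tp: "((g ^^ i) x, (g ^^ i) y) \<in> T" if "(x, y) \<in> T" for i x y
    using that T by (induction i) auto
  have rr: "r = Suc (r - 1)" using r by simp
  have inv: "(g ^^ (r - 1)) (g x) = x" "g ((g ^^ (r - 1)) x) = x" if "x \<in> carrier A" for x
  proof -
    have "(g ^^ (r - 1)) (g x) = (g ^^ r) x" "g ((g ^^ (r - 1)) x) = (g ^^ r) x"
      by (subst (2) rr, simp add: funpow_swap1)+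
    then show "(g ^^ (r - 1)) (g x) = x" "g ((g ^^ (r - 1)) x) = x" using fin[OF that] by simp_all
  qed
  let ?E = "(g ^^ (r - 1)) ` E"
  have "?E = B"
  proof (rule Block_maximal[OF B])
    show "?E \<subseteq> carrier A" using clp BlockD(1)[OF E] by auto
    show "?E \<times> ?E \<subseteq> T" using Tp BlockD(2)[OF E] by auto
    show "B \<subseteq> ?E"
    proof
      fix b assume b: "b \<in> B"
      then have "b = (g ^^ (r - 1)) (g b)" using inv(1)[of b] BlockD(1)[OF B] by auto
      then show "b \<in> ?E" using sub b by auto
    qed
  qed
  then have "E \<subseteq> g ` B" using inv(2) BlockD(1)[OF E] by force
  then show ?thesis using sub by blast
qed

section \<open>Quotients of lattices with an automorphism\<close>

lemma RLat_factorable: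
  assumes m: "1 \<le> m" and n: "1 \<le> n" and A: "A \<in> RLat_ext m n" and T: "tolerance (C_type m n) A T"
  shows "factorable (C_type m n) A T"
proof (rule factorableI[OF RLat_extD(15)[OF A] T])
  interpret tol_lattice "carrier A" "\<lambda>x y. opn A Join [x, y]" "\<lambda>x y. opn A Meet [x, y]" T A
    by (rule RLat_tol_lattice[OF A T])
  note alg = RLat_extD(15)[OF A] and compat = toleranceD(4)[OF T]
  fix f r and Bs :: "'a set list" and E E'
  assume f: "C_type m n f = Some r" and Bs: "length Bs = r" "set Bs \<subseteq> Block A T"
    and E: "E \<in> Block A T" "set_op A f Bs \<subseteq> E" and E': "E' \<in> Block A T" "set_op A f Bs \<subseteq> E'"
  from f show "E = E'"
  proof (cases rule: C_type_cases)
    case 1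
    then obtain B D where "Bs = [B, D]" using Bs by (auto simp: length_2)
    then show ?thesis using join_unique[of B D E E'] Bs E E' 1 by (auto simp: set_op_binary)
  next
    case 2
    then obtain B D where "Bs = [B, D]" using Bs by (auto simp: length_2)
    then show ?thesis using tol_lattice.join_unique[OF dual, of B D E E'] Bs E E' 2 by (auto simp: set_op_binary)
  next
    case 3
    then obtain B where B: "Bs = [B]" "B \<in> Block A T" using Bs by (auto simp: length_Suc_conv)
    have "X = (\<lambda>x. opn A (G m) [x]) ` B" if "X \<in> Block A T" "set_op A f Bs \<subseteq> X" for X
      by (rule aut_block_unique[OF RLat_extD(3)[OF A] RLat_extD(12)[OF A] m _ B(2) that(1)])
        (use that 3 B compatible_unary[OF compat, of "G m"] in \<open>auto simp: set_op_unary\<close>)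
    then show ?thesis using E E' by metis
  next
    case 4
    then have "X = Bs ! (1 - 1)" if "X \<in> Block A T" "set_op A f Bs \<subseteq> X" for X
      using proj_block_unique[OF alg T RLat_extD(13)[OF A] _ n _ Bs(2) that(1)] Bs(1) that(2) by simp
    then show ?thesis using E E' by metis
  next
    case 5
    then have "X = Bs ! (1 - 1)" if "X \<in> Block A T" "set_op A f Bs \<subseteq> X" for X
      using proj_block_unique[OF alg T RLat_extD(14)[OF A] _ _ _ Bs(2) that(1)] Bs(1) that(2) by simp
    then show ?thesis using E E' by metis
  qed
qed

lemma RLat_quotient:
  assumes m: "1 \<le> m" and n: "1 \<le> n" and A: "A \<in> RLat_ext m n" and T: "tolerance (C_type m n) A T"
  shows "quotient_alg A T \<in> RLat_ext m n"
proof -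
  interpret tol_lattice "carrier A" "\<lambda>x y. opn A Join [x, y]" "\<lambda>x y. opn A Meet [x, y]" T A
    by (rule RLat_tol_lattice[OF A T])
  interpret d: tol_lattice "carrier A" "\<lambda>x y. opn A Meet [x, y]" "\<lambda>x y. opn A Join [x, y]" T A
    by (rule dual)
  note alg = RLat_extD(15)[OF A] and compat = toleranceD(4)[OF T]
  note fact = RLat_factorable[OF m n A T]
  let ?Q = "quotient_alg A T" and ?B = "Block A T"
  let ?g = "\<lambda>x. opn A (G m) [x]"
  note J = quotient_binary[OF fact, of Join, OF C_type_simps(1)]
  note M = quotient_binary[OF fact, of Meet, OF C_type_simps(2)]
  have Gm: "opn ?Q (G m) [B] = ?g ` B" "?g ` B \<in> ?B" if B: "B \<in> ?B" for B
  proof -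
    have 1: "opn ?Q (G m) [B] \<in> ?B" "?g ` B \<subseteq> opn ?Q (G m) [B]"
      using quotient_opn(1,2)[OF fact, of "G m" 1 "[B]"] B by (simp_all add: set_op_unary image_subset_iff)
    show "opn ?Q (G m) [B] = ?g ` B"
      by (rule aut_block_unique[OF RLat_extD(3)[OF A] RLat_extD(12)[OF A] m _ B 1])
        (use compatible_unary[OF compat, of "G m"] in auto)
    then show "?g ` B \<in> ?B" using 1 by simp
  qed
  note bs = block_sub
  show ?thesis
  proof (rule RLat_extI[OF quotient_algebra[OF alg fact] m]; (unfold carrier_quotient)?)
    fix B D assume B: "B \<in> ?B" and D: "D \<in> ?B"
    show "opn ?Q Join [B, D] = opn ?Q Join [D, B]"
    proof (rule J(3)[OF B D J(1)[OF D B]])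
      fix b d assume "b \<in> B" "d \<in> D"
      then show "opn A Join [b, d] \<in> opn ?Q Join [D, B]"
        using J(2)[OF D B, of d b] jcomm[of b d] bs[OF B] bs[OF D] by simp
    qed
    show "opn ?Q Meet [B, D] = opn ?Q Meet [D, B]"
    proof (rule M(3)[OF B D M(1)[OF D B]])
      fix b d assume "b \<in> B" "d \<in> D"
      then show "opn A Meet [b, d] \<in> opn ?Q Meet [D, B]"
        using M(2)[OF D B, of d b] kcomm[of b d] bs[OF B] bs[OF D] by simp
    qed
    show "opn ?Q Join [B, opn ?Q Meet [B, D]] = B"
      by (rule join_absorb[OF B D M(1)[OF B D] M(2)[OF B D] J(1)[OF B M(1)[OF B D]] J(2)[OF B M(1)[OF B D]]])
    show "opn ?Q Meet [B, opn ?Q Join [B, D]] = B"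
      by (rule d.join_absorb[OF B D J(1)[OF B D] J(2)[OF B D] M(1)[OF B J(1)[OF B D]] M(2)[OF B J(1)[OF B D]]])
    show "opn ?Q (G m) [opn ?Q Join [B, D]] = opn ?Q Join [opn ?Q (G m) [B], opn ?Q (G m) [D]]"
      unfolding Gm(1)[OF B] Gm(1)[OF D] Gm(1)[OF J(1)[OF B D]]
    proof (rule J(3)[OF Gm(2)[OF B] Gm(2)[OF D] Gm(2)[OF J(1)[OF B D]], symmetric])
      fix x y assume "x \<in> ?g ` B" "y \<in> ?g ` D"
      then obtain b d where "b \<in> B" "x = ?g b" "d \<in> D" "y = ?g d" by auto
      then show "opn A Join [x, y] \<in> ?g ` opn ?Q Join [B, D]"
        using J(2)[OF B D] RLat_extD(10)[OF A, of b d] bs[OF B] bs[OF D]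
        by (intro image_eqI[of _ _ "opn A Join [b, d]"]) simp_all
    qed
    show "opn ?Q (G m) [opn ?Q Meet [B, D]] = opn ?Q Meet [opn ?Q (G m) [B], opn ?Q (G m) [D]]"
      unfolding Gm(1)[OF B] Gm(1)[OF D] Gm(1)[OF M(1)[OF B D]]
    proof (rule M(3)[OF Gm(2)[OF B] Gm(2)[OF D] Gm(2)[OF M(1)[OF B D]], symmetric])
      fix x y assume "x \<in> ?g ` B" "y \<in> ?g ` D"
      then obtain b d where "b \<in> B" "x = ?g b" "d \<in> D" "y = ?g d" by auto
      then show "opn A Meet [x, y] \<in> ?g ` opn ?Q Meet [B, D]"
        using M(2)[OF B D] RLat_extD(11)[OF A, of b d] bs[OF B] bs[OF D]
        by (intro image_eqI[of _ _ "opn A Meet [b, d]"]) simp_all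
    qed
    \<comment> \<open>The claim that the images are blocks is carried along because
      \<open>Gm\<close> needs it at the next iterate.\<close>
    have "((\<lambda>B. opn ?Q (G m) [B]) ^^ i) B = (?g ^^ i) ` B \<and> (?g ^^ i) ` B \<in> ?B" for i
    proof (induction i)
      case (Suc i)
      then show ?case using Gm[of "(?g ^^ i) ` B"] by (simp add: image_image)
    qed (use B in simp)
    moreover have "(?g ^^ m) ` B = B" using RLat_extD(12)[OF A] bs[OF B] by force
    ultimately show "((\<lambda>B. opn ?Q (G m) [B]) ^^ m) B = B" by simp
    fix E assume E: "E \<in> ?B"
    show "opn ?Q Join [opn ?Q Join [B, D], E] = opn ?Q Join [B, opn ?Q Join [D, E]]"
      by (rule join_assoc[OF B D E J(1,2)[OF B D] J(1,2)[OF D E] J(1,2)[OF J(1)[OF B D] E] J(1,2)[OF B J(1)[OF D E]]])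
    show "opn ?Q Meet [opn ?Q Meet [B, D], E] = opn ?Q Meet [B, opn ?Q Meet [D, E]]"
      by (rule d.join_assoc[OF B D E M(1,2)[OF B D] M(1,2)[OF D E] M(1,2)[OF M(1)[OF B D] E] M(1,2)[OF B M(1)[OF D E]]])
  next
    show "acts_as_proj ?Q (F n) n 1"
      by (rule proj_quotient[OF alg T fact RLat_extD(13)[OF A]]) (use n in auto)
    show "acts_as_proj ?Q H 2 1"
      by (rule proj_quotient[OF alg T fact RLat_extD(14)[OF A]]) auto
  qed
qed

section \<open>Strong tolerance factorability\<close>

definition proj_index :: "nat \<Rightarrow> symb \<Rightarrow> nat" where
  "proj_index k f = (case f of F i \<Rightarrow> k | H \<Rightarrow> 2 | _ \<Rightarrow> 1)"

lemma proj_index_bounds: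
  "C_type m n f = Some r \<Longrightarrow> 1 \<le> k \<Longrightarrow> k \<le> n \<Longrightarrow> 1 \<le> proj_index k f \<and> proj_index k f \<le> r"
  by (erule C_type_cases) (auto simp: proj_index_def)

lemma proj_var_proj:
  "A \<in> proj_var m n k \<Longrightarrow> C_type m n f = Some r \<Longrightarrow> acts_as_proj A f r (proj_index k f)"
  by (erule C_type_cases) (simp_all add: proj_index_def proj_var_def)

lemma factor_var_factorable:
  assumes m: "1 \<le> m" and n: "1 \<le> n" and k: "k \<le> n" and A: "A \<in> factor_var m n k"
    and T: "tolerance (C_type m n) A T"
  shows "factorable (C_type m n) A T" and "quotient_alg A T \<in> factor_var m n k"
proof -
  have "factorable (C_type m n) A T \<and> quotient_alg A T \<in> factor_var m n k"
  proof (cases "k = 0")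
    case True
    then have A': "A \<in> RLat_ext m n" using A by (simp add: factor_var_def)
    show ?thesis
      using RLat_factorable[OF m n A' T] RLat_quotient[OF m n A' T] True by (simp add: factor_var_def)
  next
    case False
    then have k: "1 \<le> k" "k \<le> n" using k by simp_all
    have A': "A \<in> proj_var m n k" using A False by (simp add: factor_var_def)
    note alg = factor_var_algebra[OF A]
    have fact: "factorable (C_type m n) A T"
    proof (rule factorableI[OF alg T])
      fix f r and Bs :: "'a set list" and E E'
      assume f: "C_type m n f = Some r" and *: "length Bs = r" "set Bs \<subseteq> Block A T"
        "E \<in> Block A T" "set_op A f Bs \<subseteq> E" "E' \<in> Block A T" "set_op A f Bs \<subseteq> E'"
      show "E = E'"
        using proj_block_unique[OF alg T proj_var_proj[OF A' f] _ _ *(1,2,3,4)]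
          proj_block_unique[OF alg T proj_var_proj[OF A' f] _ _ *(1,2,5,6)] proj_index_bounds[OF f k] by simp
    qed
    note pq = proj_quotient[OF alg T fact]
    have "quotient_alg A T \<in> proj_var m n k"
      using A' k quotient_algebra[OF alg fact] by (simp add: proj_var_def pq)
    then show ?thesis using fact False by (simp add: factor_var_def)
  qed
  then show "factorable (C_type m n) A T" "quotient_alg A T \<in> factor_var m n k" by simp_all
qed

lemma dd_compatible:
  assumes "compatible (C_type m n) A R" "length xs = Suc n" "length ys = Suc n"
    "\<And>i. i \<le> n \<Longrightarrow> (xs ! i, ys ! i) \<in> R"
  shows "(dd n A xs, dd n A ys) \<in> R"
proof -
  have "(opn A (F n) (tl xs), opn A (F n) (tl ys)) \<in> R"
    by (rule compatibleD[OF assms(1)])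
      (use assms(2,3) assms(4)[of "Suc _"] in \<open>auto simp: list_all2_conv_all_nth nth_tl\<close>)
  then show ?thesis unfolding dd_def
    by (intro compatible_binary[OF assms(1)]) (use assms in auto)
qed

section \<open>Tolerances and blocks of a direct product\<close>

context C_member
begin

context
  fixes T assumes T: "tolerance (C_type m n) A T"
begin

text \<open>For \<open>k \<le> n\<close> this restriction is also the image of \<open>T\<close>,
  because \<open>\<pi> k\<close> preserves \<open>T\<close> and fixes the carrier of the
  factor.\<close>

definition fac_tol :: "nat \<Rightarrow> ('a \<times> 'a) set" where
  "fac_tol k = T \<inter> carrier (fac n A c k) \<times> carrier (fac n A c k)"

lemma prj_tol:
  assumes "(x, y) \<in> T"
  shows "(\<pi> k x, \<pi> k y) \<in> T"
  unfolding prj_def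
proof (rule dd_compatible[OF toleranceD(4)[OF T]])
  fix i assume i: "i \<le> n"
  have "(c, c) \<in> T" using c toleranceD(2)[OF T] by (auto simp: refl_on_def)
  then show "((replicate (Suc n) c)[k := x] ! i, (replicate (Suc n) c)[k := y] ! i) \<in> T"
    using assms i by (cases "i = k") (simp_all del: replicate_Suc)
qed (simp_all del: replicate_Suc)

lemma tol_from_prj:
  assumes "x \<in> carrier A" "y \<in> carrier A" "\<And>k. k \<le> n \<Longrightarrow> (\<pi> k x, \<pi> k y) \<in> T"
  shows "(x, y) \<in> T"
proof -
  have "(dd n A (map (\<lambda>k. \<pi> k x) [0..<Suc n]), dd n A (map (\<lambda>k. \<pi> k y) [0..<Suc n])) \<in> T"
    by (rule dd_compatible[OF toleranceD(4)[OF T]]) (use assms(3) in \<open>auto simp del: upt_Suc\<close>)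
  then show ?thesis by (simp only: dd_prj assms(1,2))
qed

lemma fac_tol_tolerance: "tolerance (C_type m n) (fac n A c k) (fac_tol k)"
  unfolding tolerance_def
proof (intro conjI)
  show "fac_tol k \<subseteq> carrier (fac n A c k) \<times> carrier (fac n A c k)" by (auto simp: fac_tol_def)
  show "refl_on (carrier (fac n A c k)) (fac_tol k)"
    using toleranceD(2)[OF T] fac_subset[of k] by (auto simp: refl_on_def fac_tol_def)
  show "sym (fac_tol k)" using toleranceD(3)[OF T] by (auto simp: sym_def fac_tol_def)
  show "compatible (C_type m n) (fac n A c k) (fac_tol k)"
    unfolding compatible_def
  proof (intro allI impI, elim conjE)
    fix f r xs ys
    assume f: "C_type m n f = Some r" and l: "length xs = r" "length ys = r"
      and a: "list_all2 (\<lambda>x y. (x, y) \<in> fac_tol k) xs ys"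
    have "list_all2 (\<lambda>x y. (x, y) \<in> T) xs ys"
      by (rule list_all2_mono[OF a]) (simp add: fac_tol_def)
    then have "(opn A f xs, opn A f ys) \<in> T"
      by (intro compatibleD[OF toleranceD(4)[OF T]]) (simp_all add: f l)
    then have "(opn (fac n A c k) f xs, opn (fac n A c k) f ys) \<in> T"
      by (simp add: fac_def prj_tol)
    moreover have "set xs \<subseteq> carrier (fac n A c k)" "set ys \<subseteq> carrier (fac n A c k)"
      using list_all2_subset[OF _ a, of "carrier (fac n A c k)" "carrier (fac n A c k)"]
      by (simp_all add: fac_tol_def)
    then have "opn (fac n A c k) f xs \<in> carrier (fac n A c k)"
      "opn (fac n A c k) f ys \<in> carrier (fac n A c k)"
      using is_algebraD[OF fac_algebra f] l by blast+
    ultimately show "(opn (fac n A c k) f xs, opn (fac n A c k) f ys) \<in> fac_tol k"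
      by (simp add: fac_tol_def)
  qed
qed

lemma block_prj_tol: "E \<in> Block A T \<Longrightarrow> u \<in> \<pi> k ` E \<Longrightarrow> v \<in> \<pi> k ` E \<Longrightarrow> (u, v) \<in> T"
  using BlockD(2)[of E A T] by (auto intro!: prj_tol)

text \<open>The set of all elements with coordinates in the images of \<open>E\<close> has all its
  pairs in \<open>T\<close>, since \<open>T\<close> is tested coordinatewise; maximality of
  \<open>E\<close> does the rest.\<close>

lemma block_recover:
  assumes E: "E \<in> Block A T"
  shows "{x \<in> carrier A. \<forall>k\<le>n. \<pi> k x \<in> \<pi> k ` E} = E" (is "?P = E")
proof (rule Block_maximal[OF E])
  show "?P \<times> ?P \<subseteq> T"
  proof (clarify, rule tol_from_prj)
    fix x y k assume k: "k \<le> n" and "\<forall>k\<le>n. \<pi> k x \<in> \<pi> k ` E" "\<forall>k\<le>n. \<pi> k y \<in> \<pi> k ` E"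
    then show "(\<pi> k x, \<pi> k y) \<in> T" using block_prj_tol[OF E] by blast
  qed
  show "?P \<subseteq> carrier A" by auto
  show "E \<subseteq> ?P" using BlockD(1)[OF E] by auto
qed

lemma block_eq_prj:
  assumes E: "E \<in> Block A T" "E' \<in> Block A T" and eq: "\<And>k. k \<le> n \<Longrightarrow> \<pi> k ` E = \<pi> k ` E'"
  shows "E = E'"
proof -
  have "{x \<in> carrier A. \<forall>k\<le>n. \<pi> k x \<in> \<pi> k ` E} = {x \<in> carrier A. \<forall>k\<le>n. \<pi> k x \<in> \<pi> k ` E'}"
    by (simp add: eq cong: conj_cong)
  then show ?thesis by (simp only: block_recover E)
qed

text \<open>If \<open>D\<close> enlarged the image in coordinate \<open>k\<close>, the product of
  \<open>D\<close> with the other images of \<open>E\<close> would still have all pairs in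
  \<open>T\<close> and contain \<open>E\<close>, hence equal \<open>E\<close>; projecting it back
  shows that \<open>D\<close> is not larger.\<close>

lemma block_prj:
  assumes E: "E \<in> Block A T" and k: "k \<le> n"
  shows "\<pi> k ` E \<in> Block (fac n A c k) (fac_tol k)"
proof -
  have ET: "\<pi> k ` E \<times> \<pi> k ` E \<subseteq> fac_tol k"
    using BlockD[OF E] by (auto simp: fac_tol_def intro!: prj_tol)
  have "D = \<pi> k ` E"
    if D: "D \<subseteq> carrier (fac n A c k)" "D \<times> D \<subseteq> fac_tol k" "\<pi> k ` E \<subseteq> D" for D
  proof -
    let ?P = "{x \<in> carrier A. \<pi> k x \<in> D \<and> (\<forall>l\<le>n. l \<noteq> k \<longrightarrow> \<pi> l x \<in> \<pi> l ` E)}"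
    have "?P = E"
    proof (rule Block_maximal[OF E])
      show "?P \<times> ?P \<subseteq> T"
      proof (clarify, rule tol_from_prj)
        fix x y l assume l: "l \<le> n" and xy: "\<pi> k x \<in> D" "\<pi> k y \<in> D"
          "\<forall>l\<le>n. l \<noteq> k \<longrightarrow> \<pi> l x \<in> \<pi> l ` E" "\<forall>l\<le>n. l \<noteq> k \<longrightarrow> \<pi> l y \<in> \<pi> l ` E"
        show "(\<pi> l x, \<pi> l y) \<in> T"
        proof (cases "l = k")
          case True
          then show ?thesis using xy D(2) by (auto simp: fac_tol_def)
        next
          case False
          then have "\<pi> l x \<in> \<pi> l ` E" "\<pi> l y \<in> \<pi> l ` E" using xy(3,4) l by simp_all
          then show ?thesis by (rule block_prj_tol[OF E])
        qed
      qed
      show "?P \<subseteq> carrier A" by auto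
      show "E \<subseteq> ?P" using BlockD(1)[OF E] D(3) by auto
    qed
    moreover obtain b where b: "b \<in> E" "b \<in> carrier A"
      using Block_nonempty[OF E toleranceD(3,2)[OF T]] c BlockD(1)[OF E] by auto
    have "y \<in> \<pi> k ` E" if y: "y \<in> D" for y
    proof -
      have yA: "y \<in> carrier A" "\<pi> k y = y" using y D(1) prj_closed prj_prj[OF k] by auto
      \<comment> \<open>The coordinates of some \<open>b\<close> in \<open>E\<close> with
        \<open>y\<close> put in place \<open>k\<close>; \<open>dd\<close> assembles them into an
        element of \<open>?P\<close> that projects to \<open>y\<close>.\<close>
      define xs where "xs = (map (\<lambda>l. \<pi> l b) [0..<Suc n])[k := y]"
      have xs: "length xs = Suc n" by (simp add: xs_def del: upt_Suc)
      have xs_nth: "xs ! l = (if l = k then y else \<pi> l b)" if "l \<le> n" for l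
        using that k by (simp add: xs_def nth_list_update del: upt_Suc)
      have xsA: "set xs \<subseteq> carrier A"
        using yA b prj_closed xs xs_nth by (auto simp: in_set_conv_nth less_Suc_eq_le)
      have 1: "\<pi> l (dd n A xs) = \<pi> l (xs ! l)" if "l \<le> n" for l
        by (rule prj_dd[OF that xs xsA])
      have k1: "\<pi> k (dd n A xs) = y" using 1[OF k] xs_nth[OF k] yA by simp
      have "\<pi> l (dd n A xs) = \<pi> l b" if "l \<le> n" "l \<noteq> k" for l
        using 1[OF that(1)] xs_nth[OF that(1)] that prj_prj[OF that(1) b(2)] by simp
      then have "dd n A xs \<in> ?P" using k1 y b dd_closed[OF xs xsA] by auto
      then have "dd n A xs \<in> E" using \<open>?P = E\<close> by simp
      then show ?thesis using k1 by force
    qed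
    then show ?thesis using D(3) by blast
  qed
  then show ?thesis unfolding Block_def using ET BlockD(1)[OF E] by auto
qed

lemma prj_set_op:
  assumes f: "C_type m n f = Some r" and Bs: "length Bs = r" "set Bs \<subseteq> Block A T"
    and sub: "set_op A f Bs \<subseteq> E" and k: "k \<le> n"
  shows "set_op (fac n A c k) f (map ((`) (\<pi> k)) Bs) \<subseteq> \<pi> k ` E"
  unfolding set_op_subset
proof (intro allI impI)
  fix ys assume "list_all2 (\<lambda>b B. b \<in> B) ys (map ((`) (\<pi> k)) Bs)"
  then have ys: "length ys = length Bs" "\<And>i. i < length Bs \<Longrightarrow> ys ! i \<in> \<pi> k ` (Bs ! i)"
    by (auto simp: list_all2_conv_all_nth)
  then have "\<forall>i. \<exists>b. i < length Bs \<longrightarrow> b \<in> Bs ! i \<and> ys ! i = \<pi> k b" by blast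
  then obtain b where b: "\<And>i. i < length Bs \<Longrightarrow> b i \<in> Bs ! i \<and> ys ! i = \<pi> k (b i)" by metis
  let ?bs = "map b [0..<length Bs]"
  have "b i \<in> carrier A" if "i < length Bs" for i
    using b[OF that] Bs(2) nth_mem[OF that] BlockD(1) by blast
  then have bsA: "set ?bs \<subseteq> carrier A" by auto
  have "list_all2 (\<lambda>b B. b \<in> B) ?bs Bs" using b by (auto simp: list_all2_conv_all_nth)
  then have "opn A f ?bs \<in> E" using sub unfolding set_op_subset by simp
  moreover have "map (\<pi> k) ?bs = ys" using b ys(1) by (auto intro!: nth_equalityI)
  then have "\<pi> k (opn A f ?bs) = opn (fac n A c k) f ys"
    using prj_opn[OF k f _ bsA] Bs(1) by (simp add: fac_def)
  ultimately show "opn (fac n A c k) f ys \<in> \<pi> k ` E" by force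
qed

lemma C_factorable: "factorable (C_type m n) A T"
proof (rule factorableI[OF alg T])
  fix f r and Bs :: "'a set list" and E E'
  assume f: "C_type m n f = Some r" and Bs: "length Bs = r" "set Bs \<subseteq> Block A T"
    and E: "E \<in> Block A T" "set_op A f Bs \<subseteq> E" and E': "E' \<in> Block A T" "set_op A f Bs \<subseteq> E'"
  have "\<pi> k ` E = \<pi> k ` E'" if k: "k \<le> n" for k
  proof -
    let ?Bs = "map ((`) (\<pi> k)) Bs"
    have "length ?Bs = r" "set ?Bs \<subseteq> Block (fac n A c k) (fac_tol k)"
      using Bs block_prj[OF _ k] by auto
    note q = quotient_opn(3)[OF factor_var_factorable(1)[OF m n k fac_factor_var[OF k] fac_tol_tolerance] f this]
    show ?thesis
      using q[OF block_prj[OF E(1) k] prj_set_op[OF f Bs E(2) k]]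
        q[OF block_prj[OF E'(1) k] prj_set_op[OF f Bs E'(2) k]] by simp
  qed
  then show "E = E'" by (rule block_eq_prj[OF E(1) E'(1)])
qed

text \<open>Taking images under \<open>\<pi> k\<close> is a homomorphism into the quotient of the
  factor, and these maps together separate blocks.\<close>

lemma C_quotient: "quotient_alg A T \<in> C m n"
proof (rule C_subdirect[OF n quotient_algebra[OF alg C_factorable]])
  let ?Q = "\<lambda>k. quotient_alg (fac n A c k) (fac_tol k)"
  fix k assume k: "k \<le> n"
  note fv = factor_var_factorable[OF m n k fac_factor_var[OF k] fac_tol_tolerance]
  show "?Q k \<in> factor_var m n k" by (rule fv)
  show "alg_hom (C_type m n) (quotient_alg A T) (?Q k) ((`) (\<pi> k))"
    unfolding alg_hom_def carrier_quotient
  proof (intro conjI ballI allI impI; (elim conjE)?)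
    fix E assume "E \<in> Block A T"
    then show "\<pi> k ` E \<in> Block (fac n A c k) (fac_tol k)" by (rule block_prj[OF _ k])
  next
    fix f r Bs assume f: "C_type m n f = Some r" and Bs: "length Bs = r" "set Bs \<subseteq> Block A T"
    let ?Bs = "map ((`) (\<pi> k)) Bs"
    have Bs': "length ?Bs = r" "set ?Bs \<subseteq> Block (fac n A c k) (fac_tol k)"
      using Bs block_prj[OF _ k] by auto
    note q = quotient_opn[OF C_factorable f Bs]
    show "\<pi> k ` opn (quotient_alg A T) f Bs = opn (?Q k) f ?Bs"
      by (rule quotient_opn(3)[OF fv(1) f Bs' block_prj[OF q(1) k] prj_set_op[OF f Bs q(2) k], symmetric])
  qed
next
  fix E E' assume E: "E \<in> carrier (quotient_alg A T)" "E' \<in> carrier (quotient_alg A T)"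
    and eq: "\<And>k. k \<le> n \<Longrightarrow> \<pi> k ` E = \<pi> k ` E'"
  show "E = E'" by (rule block_eq_prj[OF _ _ eq]) (use E in simp_all)
qed

end

end

lemma C_strongly_tolerance_factorable:
  assumes "1 \<le> m" "1 \<le> n"
  shows "strongly_tolerance_factorable (C_type m n) (C m n :: (symb, 'a) alg set) (C m n)"
proof -
  have "factorable (C_type m n) A T \<and> quotient_alg A T \<in> C m n"
    if A: "A \<in> C m n" and T: "tolerance (C_type m n) A T" for A :: "(symb, 'a) alg" and T
  proof -
    obtain c where "c \<in> carrier A" using C_algebra[OF A] by (auto simp: is_algebra_def)
    then interpret C_member m n A c using assms A by unfold_locales
    show ?thesis using C_factorable[OF T] C_quotient[OF T] by simp
  qed
  then show ?thesis
    unfolding strongly_tolerance_factorable_def tolerance_factorable_def tolerance_factorable_alg_def by simp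
qed

subsection \<open>Proper tolerances\<close>

definition proj_alg :: "'a set \<Rightarrow> nat \<Rightarrow> (symb, 'a) alg" where
  "proj_alg X k = \<lparr>carrier = X, opn = (\<lambda>f xs. xs ! (proj_index k f - 1))\<rparr>"

lemma proj_alg_proj_var:
  assumes "X \<noteq> {}" "1 \<le> k" "k \<le> n"
  shows "proj_alg X k \<in> proj_var m n k"
proof -
  have "opn (proj_alg X k) f xs \<in> X"
    if f: "C_type m n f = Some r" and xs: "length xs = r" "set xs \<subseteq> X" for f r xs
  proof -
    have "proj_index k f - 1 < length xs" using proj_index_bounds[OF f assms(2,3)] xs by auto
    then show ?thesis using xs(2) nth_mem by (auto simp: proj_alg_def)
  qed
  then have "is_algebra (C_type m n) (proj_alg X k)"
    using assms(1) by (simp add: is_algebra_def proj_alg_def)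
  then show ?thesis by (simp add: proj_var_def acts_as_proj_def proj_alg_def proj_index_def)
qed

lemma factor_var_C:
  assumes "1 \<le> n" "k \<le> n" "A \<in> factor_var m n k"
  shows "A \<in> C m n"
proof -
  have "A \<in> RLat_ext m n \<union> S_ext m n" by (rule factor_var_subset[OF assms])
  then show ?thesis unfolding C_def variety_join_def by auto
qed

lemma proj_alg_C:
  assumes "X \<noteq> {}" "1 \<le> k" "k \<le> n"
  shows "proj_alg X k \<in> C m n"
proof (rule factor_var_C)
  show "proj_alg X k \<in> factor_var m n k" using proj_alg_proj_var[OF assms] assms by (simp add: factor_var_def)
qed (use assms in auto)

text \<open>A projection applied to related arguments returns one of the related pairs, so every
  relation on the carrier qualifies.\<close>

lemma proj_var_compatible:
  assumes A: "A \<in> proj_var m n k" and k: "1 \<le> k" "k \<le> n" and R: "R \<subseteq> carrier A \<times> carrier A"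
  shows "compatible (C_type m n) A R"
  unfolding compatible_def
proof (intro allI impI, elim conjE)
  fix f r xs ys
  assume f: "C_type m n f = Some r" and l: "length xs = r" "length ys = r" "list_all2 (\<lambda>x y. (x, y) \<in> R) xs ys"
  then have 1: "(xs ! i, ys ! i) \<in> R" if "i < r" for i using that by (simp add: list_all2_conv_all_nth)
  have "opn A f xs = xs ! (proj_index k f - 1)" "opn A f ys = ys ! (proj_index k f - 1)"
    using acts_as_projD[OF proj_var_proj[OF A f]] list_all2_subset[OF R l(3)] l(1,2) by simp_all
  then show "(opn A f xs, opn A f ys) \<in> R"
    using 1[of "proj_index k f - 1"] proj_index_bounds[OF f k] by (cases "proj_index k f") simp_all
qed

lemma C_has_proper_tolerances:
  assumes inf: "infinite (UNIV :: 'a set)" and n: "1 \<le> n"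
  shows "has_proper_tolerances (C_type m n) (C m n :: (symb, 'a) alg set)"
proof -
  obtain X :: "'a set" where "finite X" "card X = 3" using infinite_arbitrarily_large[OF inf] by metis
  then obtain x y z where xyz: "X = {x, y, z}" "x \<noteq> y" "y \<noteq> z" "x \<noteq> z" by (auto simp: card_3_iff)
  \<comment> \<open>Two overlapping blocks: all reflexive symmetric relations are tolerances here,
    and three points are the fewest on which transitivity can fail.\<close>
  let ?A = "proj_alg X 1" and ?T = "{x, y} \<times> {x, y} \<union> {y, z} \<times> {y, z}"
  have "tolerance (C_type m n) ?A ?T"
    unfolding tolerance_def
  proof (intro conjI)
    show "compatible (C_type m n) ?A ?T"
      by (rule proj_var_compatible[OF proj_alg_proj_var _ n]) (use xyz(1) n in \<open>auto simp: proj_alg_def\<close>)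
  qed (auto simp: xyz(1) proj_alg_def refl_on_def sym_def)
  moreover have "\<not> congruence (C_type m n) ?A ?T"
  proof
    assume "congruence (C_type m n) ?A ?T"
    then have "trans ?T" by (simp add: congruence_def equiv_def)
    then have "(x, z) \<in> ?T" by (rule transD[of _ x y z]) auto
    then show False using xyz by auto
  qed
  moreover have "?A \<in> C m n" using xyz(1) n by (intro proj_alg_C) auto
  ultimately show ?thesis unfolding has_proper_tolerances_def proper_tolerance_def by blast
qed

section \<open>Term equivalence\<close>

lemma translationD:
  "translation \<tau> \<tau>' p \<Longrightarrow> \<tau> f = Some r \<Longrightarrow> wf_trm \<tau>' (p f)"
  "translation \<tau> \<tau>' p \<Longrightarrow> \<tau> f = Some r \<Longrightarrow> x \<in> vars (p f) \<Longrightarrow> x < r"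
  by (auto simp: translation_def)

lemma carrier_derived [simp]: "carrier (derived_alg p A) = carrier A"
  by (simp add: derived_alg_def)

lemma opn_derived [simp]: "opn (derived_alg p A) f xs = eval A (\<lambda>i. xs ! i) (p f)"
  by (simp add: derived_alg_def)

lemma derived_compatible:
  assumes p: "translation \<tau> \<tau>' p" and B: "compatible \<tau>' B R"
  shows "compatible \<tau> (derived_alg p B) R"
  unfolding compatible_def opn_derived
proof (intro allI impI, elim conjE)
  fix f r xs ys
  assume f: "\<tau> f = Some r" and l: "length xs = r" "list_all2 (\<lambda>x y. (x, y) \<in> R) xs ys"
  show "(eval B ((!) xs) (p f), eval B ((!) ys) (p f)) \<in> R"
    by (rule eval_compatible[OF B translationD(1)[OF p f]])
      (use translationD(2)[OF p f] l in \<open>simp add: list_all2_conv_all_nth\<close>)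
qed

lemma compatible_same:
  assumes "same_alg \<tau> A B" "R \<subseteq> carrier A \<times> carrier A" "compatible \<tau> A R"
  shows "compatible \<tau> B R"
  unfolding compatible_def
proof (intro allI impI, elim conjE)
  fix f r xs ys
  assume f: "\<tau> f = Some r" and l: "length xs = r" "length ys = r" "list_all2 (\<lambda>x y. (x, y) \<in> R) xs ys"
  have "set xs \<subseteq> carrier A" "set ys \<subseteq> carrier A"
    using list_all2_subset[OF assms(2) l(3)] by auto
  then have "opn B f xs = opn A f xs" "opn B f ys = opn A f ys"
    using assms(1) f l by (simp_all add: same_alg_def)
  then show "(opn B f xs, opn B f ys) \<in> R"
    using compatibleD[OF assms(3), of f xs ys] f l by simp
qed

lemma derived_same:
  assumes q: "translation \<tau>' \<tau> q" and A: "is_algebra \<tau> A" and same: "same_alg \<tau> A B"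
  shows "same_alg \<tau>' (derived_alg q A) (derived_alg q B)"
  unfolding same_alg_def opn_derived carrier_derived
proof (intro conjI allI impI; (elim conjE)?)
  show "carrier A = carrier B" using same by (simp add: same_alg_def)
  fix f r xs assume f: "\<tau>' f = Some r" and xs: "length xs = r" "set xs \<subseteq> carrier A"
  show "eval A ((!) xs) (q f) = eval B ((!) xs) (q f)"
    by (rule eval_alg_hom[OF A same_alg_hom[OF same] translationD(1)[OF q f]])
      (use translationD(2)[OF q f] xs in auto)
qed

text \<open>Algebras that agree on the meaningful arguments may differ as records. Even the identity
  translation returns the original algebra only up to \<open>same_alg\<close>.\<close>

lemma C_same:
  assumes n: "1 \<le> n" and B: "B \<in> C m n" and same: "same_alg (C_type m n) A B"
  shows "A \<in> C m n"
  by (rule C_I[OF n is_algebra_same[OF same C_algebra[OF B]]])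
    (rule satisfies_same[OF same C_algebra[OF B]], assumption+, rule C_satisfies[OF n B])

lemma term_equivalent_refl:
  assumes n: "1 \<le> n"
  shows "term_equivalent (C_type m n) (C m n) (C_type m n) (C m n)"
proof -
  define p where "p f = App f (map Var [0..<the (C_type m n f)])" for f
  have p: "translation (C_type m n) (C_type m n) p"
    by (auto simp: translation_def p_def)
  have same: "same_alg (C_type m n) (derived_alg p A) A" for A :: "(symb, 'b) alg"
    unfolding same_alg_def
  proof (intro conjI allI impI; (elim conjE)?)
    fix f r and xs :: "'b list" assume f: "C_type m n f = Some r" and xs: "length xs = r"
    have "map ((!) xs) [0..<r] = xs" using xs by (auto intro: nth_equalityI)
    then show "opn (derived_alg p A) f xs = opn A f xs" by (simp add: p_def f comp_def)
  qed simp
  have C: "derived_alg p A \<in> C m n" if "A \<in> C m n" for A :: "(symb, 'b) alg"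
    by (rule C_same[OF n that same])
  show ?thesis unfolding term_equivalent_def
    using p C same same_alg_trans[OF same same] by blast
qed

section \<open>Subalgebras and two-element members\<close>

lemma eval_carrier_update: "eval (B\<lparr>carrier := X\<rparr>) \<sigma> t = eval B \<sigma> t"
proof (induction t)
  case (App f ts)
  then have "map (eval (B\<lparr>carrier := X\<rparr>) \<sigma>) ts = map (eval B \<sigma>) ts" by simp
  then show ?case by (simp only: eval.simps) simp
qed simp

text \<open>Closure of \<open>X\<close> is expressed as compatibility of \<open>Id_on X\<close>, so
  that subalgebras pass through translations in the same way as other compatible relations.\<close>

lemma C_subalgebra:
  assumes n: "1 \<le> n" and B: "B \<in> C m n" and X: "X \<subseteq> carrier B" "X \<noteq> {}"
    and cl: "compatible (C_type m n) B (Id_on X)"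
  shows "B\<lparr>carrier := X\<rparr> \<in> C m n"
proof (rule C_I[OF n])
  have "opn B f xs \<in> X" if "C_type m n f = Some (length xs)" "set xs \<subseteq> X" for f xs
  proof -
    have "list_all2 (\<lambda>x y. (x, y) \<in> Id_on X) xs xs"
      using that(2) by (auto simp: list_all2_conv_all_nth)
    then show ?thesis using compatibleD[OF cl that(1)] by auto
  qed
  then show "is_algebra (C_type m n) (B\<lparr>carrier := X\<rparr>)" using X by (auto simp: is_algebra_def)
  fix s t assume wf: "wf_trm (C_type m n) s" "wf_trm (C_type m n) t"
    and "\<And>k A. k \<le> n \<Longrightarrow> A \<in> factor_var m n k \<Longrightarrow> satisfies (A :: (symb, 'a) alg) (s, t)"
  then have "satisfies B (s, t)" by (intro C_satisfies[OF n B])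
  then show "satisfies (B\<lparr>carrier := X\<rparr>) (s, t)"
    using X by (auto simp: satisfies_def eval_carrier_update)
qed

lemma (in C_member) factor_var_if_prj_id:
  assumes k: "k \<le> n" and id: "\<And>x. x \<in> carrier A \<Longrightarrow> \<pi> k x = x"
  shows "A \<in> factor_var m n k"
proof -
  have "same_alg (C_type m n) A (fac n A c k)"
    unfolding same_alg_def
  proof (intro conjI allI impI; (elim conjE)?)
    show "carrier A = carrier (fac n A c k)" using id by auto
    fix f r xs assume "C_type m n f = Some r" "length xs = r" "set xs \<subseteq> carrier A"
    then have "opn A f xs \<in> carrier A" by (rule is_algebraD[OF alg])
    then show "opn A f xs = opn (fac n A c k) f xs" by (simp add: fac_def id)
  qed
  then show ?thesis
    by (intro factor_var_closed[OF m n k alg]) (rule satisfies_same[OF _ fac_algebra], use fac_factor_var[OF k] in auto)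
qed

text \<open>An idempotent injective map is the identity.\<close>

lemma (in C_member) factor_var_if_prj_inj:
  assumes k: "k \<le> n" and inj: "inj_on (\<pi> k) (carrier A)"
  shows "A \<in> factor_var m n k"
proof (rule factor_var_if_prj_id[OF k])
  fix x assume x: "x \<in> carrier A"
  show "\<pi> k x = x" by (rule inj_onD[OF inj prj_prj[OF k x] prj_closed[OF x] x])
qed

text \<open>Some \<open>\<pi> k\<close> separates two distinct elements \<open>a\<close> and
  \<open>b\<close> and is then injective on the whole carrier.\<close>

lemma two_element_factor_var:
  assumes m: "1 \<le> m" and n: "1 \<le> n" and A: "A \<in> C m n" and ab: "carrier A = {a, b}"
  shows "\<exists>k\<le>n. A \<in> factor_var m n k"
proof -
  interpret C_member m n A a using m n A ab by unfold_locales auto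
  show ?thesis
  proof (cases "a = b")
    case True
    then have "A \<in> factor_var m n 0" using ab by (intro factor_var_if_prj_inj) auto
    then show ?thesis by blast
  next
    case False
    then obtain k where "k \<le> n" "\<pi> k a \<noteq> \<pi> k b" using prj_inj[of a b] ab by auto
    then have "A \<in> factor_var m n k" using ab by (intro factor_var_if_prj_inj) (auto simp: inj_on_def)
    then show ?thesis using \<open>k \<le> n\<close> by blast
  qed
qed

text \<open>\<open>Join\<close> is commutative, so compatibility would relate the join of
  \<open>a\<close> and \<open>b\<close> to itself.\<close>

lemma RLat_not_swap_compatible:
  assumes A: "A \<in> RLat_ext m n" and ab: "a \<in> carrier A" "b \<in> carrier A" "a \<noteq> b"
  shows "\<not> compatible (C_type m n) A {(a, b), (b, a)}"
proof
  assume "compatible (C_type m n) A {(a, b), (b, a)}"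
  then have "(opn A Join [a, b], opn A Join [b, a]) \<in> {(a, b), (b, a)}"
    by (rule compatible_binary) auto
  then show False using RLat_extD(4)[OF A ab(1,2)] ab(3) by auto
qed

subsection \<open>The number of projection structures determines n\<close>

lemma proj_var_same:
  assumes "A \<in> proj_var m n k" "B \<in> proj_var m n k" "carrier A = carrier B"
  shows "same_alg (C_type m n) A B"
  unfolding same_alg_def
proof (intro conjI allI impI; (elim conjE)?)
  fix f r xs assume f: "C_type m n f = Some r" and xs: "length xs = r" "set xs \<subseteq> carrier A"
  show "opn A f xs = opn B f xs"
    using acts_as_projD[OF proj_var_proj[OF assms(1) f] xs]
      acts_as_projD[OF proj_var_proj[OF assms(2) f] xs[unfolded assms(3)]] by simp
qed (rule assms)

lemma term_equivalent_le:
  assumes "1 \<le> m" "1 \<le> n" "1 \<le> j" and inf: "infinite (UNIV :: 'a set)"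
    and te: "term_equivalent (C_type m n) (C m n :: (symb, 'a) alg set) (C_type i j) (C i j)"
  shows "j \<le> n"
proof -
  obtain p q where p: "translation (C_type m n) (C_type i j) p" and q: "translation (C_type i j) (C_type m n) q"
    and pC: "\<And>B :: (symb, 'a) alg. B \<in> C i j \<Longrightarrow> derived_alg p B \<in> C m n"
    and pq: "\<And>B :: (symb, 'a) alg. B \<in> C i j \<Longrightarrow> same_alg (C_type i j) (derived_alg q (derived_alg p B)) B"
    using te unfolding term_equivalent_def by blast
  obtain X :: "'a set" where "finite X" "card X = 2" using infinite_arbitrarily_large[OF inf] by metis
  then obtain a b :: 'a where ab: "a \<noteq> b" by (auto simp: card_2_iff)
  define P where "P k = proj_alg {a, b} k" for k
  have P: "P k \<in> C i j" "P k \<in> proj_var i j k" "carrier (P k) = {a, b}" if "1 \<le> k" "k \<le> j" for k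
    using proj_alg_C[of "{a, b}" k j] proj_alg_proj_var[of "{a, b}" k j] that by (auto simp: P_def proj_alg_def)
  have "\<exists>l. 1 \<le> l \<and> l \<le> n \<and> derived_alg p (P k) \<in> proj_var m n l" if k: "1 \<le> k" "k \<le> j" for k
  proof -
    obtain l where l: "l \<le> n" "derived_alg p (P k) \<in> factor_var m n l"
      using two_element_factor_var[OF assms(1,2) pC[OF P(1)[OF k]], of a b] P(3)[OF k] by auto
    have "compatible (C_type m n) (derived_alg p (P k)) {(a, b), (b, a)}"
      by (rule derived_compatible[OF p proj_var_compatible[OF P(2)[OF k] k]]) (simp add: P(3)[OF k])
    then have "derived_alg p (P k) \<notin> RLat_ext m n"
      using RLat_not_swap_compatible[of "derived_alg p (P k)" m n a b] P(3)[OF k] ab by auto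
    then have "l \<noteq> 0" "derived_alg p (P k) \<in> proj_var m n l" using l(2) by (auto simp: factor_var_def split: if_splits)
    then show ?thesis using l(1) by (intro exI[of _ l]) simp
  qed
  then obtain \<kappa> where \<kappa>: "\<And>k. 1 \<le> k \<Longrightarrow> k \<le> j \<Longrightarrow>
      1 \<le> \<kappa> k \<and> \<kappa> k \<le> n \<and> derived_alg p (P k) \<in> proj_var m n (\<kappa> k)" by metis
  \<comment> \<open>Structures of equal index have equal operations, and \<open>q\<close> recovers
    \<open>P k\<close> and \<open>P l\<close> from them.\<close>
  have "inj_on \<kappa> {1..j}"
  proof (rule inj_onI)
    fix k l assume "k \<in> {1..j}" "l \<in> {1..j}" and eq: "\<kappa> k = \<kappa> l"
    then have k: "1 \<le> k" "k \<le> j" and l: "1 \<le> l" "l \<le> j" by auto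
    have "same_alg (C_type m n) (derived_alg p (P k)) (derived_alg p (P l))"
      using \<kappa>[OF k] \<kappa>[OF l] eq P(3)[OF k] P(3)[OF l] by (intro proj_var_same[of _ m n "\<kappa> k"]) auto
    from derived_same[OF q C_algebra[OF pC[OF P(1)[OF k]]] this]
    have same: "same_alg (C_type i j) (P k) (P l)"
      using same_alg_trans[OF same_alg_sym[OF pq[OF P(1)[OF k]]]] pq[OF P(1)[OF l]] same_alg_trans by blast
    \<comment> \<open>With \<open>b\<close> in position \<open>k\<close> only, \<open>F j\<close>
      returns \<open>b\<close> in \<open>P k\<close>, but \<open>a\<close> in \<open>P l\<close> for
      any other \<open>l\<close>.\<close>
    let ?xs = "(replicate j a)[k - 1 := b]"
    have "set ?xs \<subseteq> {a, b}" using set_update_subset_insert[of "replicate j a" "k - 1" b] by auto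
    then have "opn (P k) (F j) ?xs = opn (P l) (F j) ?xs"
      using same P(3)[OF k] by (simp add: same_alg_def)
    then have "?xs ! (k - 1) = ?xs ! (l - 1)" by (simp add: P_def proj_alg_def proj_index_def)
    then show "k = l" using k l ab by (cases "k - 1 = l - 1") auto
  qed
  moreover have "\<kappa> ` {1..j} \<subseteq> {1..n}" using \<kappa> by auto
  ultimately show ?thesis using card_inj_on_le[of \<kappa> "{1..j}" "{1..n}"] by simp
qed

subsection \<open>Diamonds with a cyclic automorphism determine m\<close>

lemma RLat_compatibleI:
  assumes A: "A \<in> RLat_ext m n" and n: "1 \<le> n" and R: "R \<subseteq> carrier A \<times> carrier A"
    and J: "\<And>x y u v. (x, y) \<in> R \<Longrightarrow> (u, v) \<in> R \<Longrightarrow> (opn A Join [x, u], opn A Join [y, v]) \<in> R"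
    and M: "\<And>x y u v. (x, y) \<in> R \<Longrightarrow> (u, v) \<in> R \<Longrightarrow> (opn A Meet [x, u], opn A Meet [y, v]) \<in> R"
    and Gm: "\<And>x y. (x, y) \<in> R \<Longrightarrow> (opn A (G m) [x], opn A (G m) [y]) \<in> R"
  shows "compatible (C_type m n) A R"
  unfolding compatible_def
proof (intro allI impI, elim conjE)
  fix f r xs ys
  assume f: "C_type m n f = Some r" and l: "length xs = r" "length ys = r" "list_all2 (\<lambda>x y. (x, y) \<in> R) xs ys"
  note sub = list_all2_subset[OF R l(3)]
  have proj: "(opn A f xs, opn A f ys) \<in> R" if "acts_as_proj A f r 1" "1 \<le> r"
  proof -
    have "(xs ! 0, ys ! 0) \<in> R" using l that(2) by (simp add: list_all2_conv_all_nth)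
    then show ?thesis using acts_as_projD[OF that(1) l(1) sub(1)] acts_as_projD[OF that(1) l(2) sub(2)] by simp
  qed
  show "(opn A f xs, opn A f ys) \<in> R"
    using f
  proof (cases rule: C_type_cases)
    case 1
    then obtain x y u v where "xs = [x, u]" "ys = [y, v]" using l by (auto simp: length_2)
    then show ?thesis using l(3) J[of x y u v] 1 by simp
  next
    case 2
    then obtain x y u v where "xs = [x, u]" "ys = [y, v]" using l by (auto simp: length_2)
    then show ?thesis using l(3) M[of x y u v] 2 by simp
  next
    case 3
    then obtain x y where "xs = [x]" "ys = [y]" using l by (auto simp: length_Suc_conv)
    then show ?thesis using l(3) Gm[of x y] 3 by simp
  next
    case 4
    then show ?thesis using proj RLat_extD(13)[OF A] n by simp
  next
    case 5
    then show ?thesis using proj RLat_extD(14)[OF A] by simp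
  qed
qed

text \<open>The atoms are indexed by all natural numbers with period \<open>i\<close>, so that the
  cyclic automorphism becomes \<open>Suc\<close> on indices. For \<open>i = 1\<close> the lattice is
  a chain of three elements.\<close>

locale diamond =
  fixes at :: "nat \<Rightarrow> 'a" and bot top :: 'a and g :: "'a \<Rightarrow> 'a" and i :: nat
  assumes i: "1 \<le> i" and bt: "bot \<noteq> top" and at_ne: "at a \<noteq> bot" "at a \<noteq> top"
    and at_eq: "at a = at b \<longleftrightarrow> a mod i = b mod i"
    and g_bot: "g bot = bot" and g_top: "g top = top" and g_at: "g (at a) = at (Suc a)"
begin

definition L :: "'a set" where "L = {bot, top} \<union> range at"

definition jn :: "'a \<Rightarrow> 'a \<Rightarrow> 'a" where
  "jn x y = (if x = y then x else if x = bot then y else if y = bot then x else top)"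

definition mt :: "'a \<Rightarrow> 'a \<Rightarrow> 'a" where
  "mt x y = (if x = y then x else if x = top then y else if y = top then x else bot)"

definition diamond_alg :: "(symb, 'a) alg" where
  "diamond_alg = \<lparr>carrier = L, opn = (\<lambda>f xs. case f of Join \<Rightarrow> jn (xs ! 0) (xs ! 1)
     | Meet \<Rightarrow> mt (xs ! 0) (xs ! 1) | G k \<Rightarrow> g (xs ! 0) | _ \<Rightarrow> xs ! 0)\<rparr>"

definition le :: "('a \<times> 'a) set" where
  "le = {(x, y) \<in> L \<times> L. x = y \<or> x = bot \<or> y = top}"

lemma diamond_simps [simp]:
  "carrier diamond_alg = L" "opn diamond_alg Join [x, y] = jn x y" "opn diamond_alg Meet [x, y] = mt x y"
  "opn diamond_alg (G k) [x] = g x"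
  by (simp_all add: diamond_alg_def)

lemma L_mem [simp]: "bot \<in> L" "top \<in> L" "at a \<in> L"
  by (auto simp: L_def)

lemma L_cases: "x \<in> L \<Longrightarrow> x = bot \<or> x = top \<or> (\<exists>a. x = at a)"
  by (auto simp: L_def)

lemma g_L: "x \<in> L \<Longrightarrow> g x \<in> L"
  using g_bot g_top g_at by (auto simp: L_def)

lemma g_pow_at: "(g ^^ r) (at a) = at (a + r)"
  by (induction r) (auto simp: g_at)

lemma g_pow_i: "x \<in> L \<Longrightarrow> (g ^^ i) x = x"
proof -
  have "(g ^^ r) bot = bot" "(g ^^ r) top = top" for r
    by (induction r) (auto simp: g_bot g_top)
  then show "x \<in> L \<Longrightarrow> (g ^^ i) x = x" by (auto simp: L_def g_pow_at at_eq)
qed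

lemma g_inj: "x \<in> L \<Longrightarrow> y \<in> L \<Longrightarrow> g x = g y \<longleftrightarrow> x = y"
  using bij_betw_funpow_id[of L g, OF g_L g_pow_i i] by (auto simp: bij_betw_def inj_on_eq_iff)

lemma g_eq: "x \<in> L \<Longrightarrow> g x = bot \<longleftrightarrow> x = bot" "x \<in> L \<Longrightarrow> g x = top \<longleftrightarrow> x = top"
  using g_inj[of x bot] g_inj[of x top] g_bot g_top by auto

lemma jn_L: "x \<in> L \<Longrightarrow> y \<in> L \<Longrightarrow> jn x y \<in> L" and mt_L: "x \<in> L \<Longrightarrow> y \<in> L \<Longrightarrow> mt x y \<in> L"
  by (simp_all add: jn_def mt_def)

lemma diamond_RLat:
  assumes n: "1 \<le> n"
  shows "diamond_alg \<in> RLat_ext i n"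
proof (rule RLat_extI[OF _ i])
  have "opn diamond_alg f xs \<in> L"
    if f: "C_type i n f = Some r" and xs: "length xs = r" "set xs \<subseteq> L" for f r xs
  proof -
    have 1: "l < r \<Longrightarrow> xs ! l \<in> L" for l using xs by auto
    show ?thesis using f
      by (rule C_type_cases) (use 1 n in \<open>simp_all add: diamond_alg_def jn_L mt_L g_L\<close>)
  qed
  then show "is_algebra (C_type i n) diamond_alg" by (auto simp: is_algebra_def L_def)
  show "((\<lambda>x. opn diamond_alg (G i) [x]) ^^ i) x = x" if "x \<in> carrier diamond_alg" for x
    using g_pow_i[of x] that by simp
  show "acts_as_proj diamond_alg (F n) n 1" "acts_as_proj diamond_alg H 2 1"
    by (simp_all add: acts_as_proj_def diamond_alg_def)
qed (use bt in \<open>auto simp: jn_def mt_def g_inj g_eq g_bot g_top\<close>)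

lemma diamond_le:
  assumes n: "1 \<le> n"
  shows "compatible (C_type i n) diamond_alg le"
  by (rule RLat_compatibleI[OF diamond_RLat[OF n] n])
    (use bt in \<open>auto simp: le_def jn_L mt_L g_L g_inj g_eq g_bot g_top, auto simp: jn_def mt_def split: if_splits\<close>)

text \<open>Compatibility of the graph says that \<open>g\<close> commutes with all operations, a
  property that derived operations inherit.\<close>

lemma diamond_graph:
  assumes n: "1 \<le> n"
  shows "compatible (C_type i n) diamond_alg {(x, g x) | x. x \<in> L}"
  by (rule RLat_compatibleI[OF diamond_RLat[OF n] n])
    (auto simp: jn_L mt_L g_L, auto simp: jn_def mt_def g_inj g_eq g_bot g_top)

lemma diamond_bounds:
  assumes n: "1 \<le> n"
  shows "compatible (C_type i n) diamond_alg (Id_on {bot, top})"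
  by (rule RLat_compatibleI[OF diamond_RLat[OF n] n]) (auto simp: jn_def mt_def g_bot g_top)

end

text \<open>An algebra on the set of elements of a diamond whose operations preserve the diamond's order, its
  automorphism and its bounds, like every algebra derived from the diamond.\<close>

locale derived_diamond = diamond at bot top g i
  for at :: "nat \<Rightarrow> 'a" and bot top g i +
  fixes m n :: nat and D :: "(symb, 'a) alg"
  assumes m: "1 \<le> m" and n: "1 \<le> n" and D: "D \<in> C m n" and carrier_D: "carrier D = L"
    and D_le: "compatible (C_type m n) D le"
    and D_graph: "compatible (C_type m n) D {(x, g x) | x. x \<in> L}"
    and D_bounds: "compatible (C_type m n) D (Id_on {bot, top})"
    and D_swap: "\<not> compatible (C_type m n) D {(bot, top), (top, bot)}"
begin

text \<open>The bounds form a two-element subalgebra, which lies in one factor variety; the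
  projection varieties would admit the swap of the bounds.\<close>

lemma bounds_RLat: "D\<lparr>carrier := {bot, top}\<rparr> \<in> RLat_ext m n"
proof -
  let ?E = "D\<lparr>carrier := {bot, top}\<rparr>"
  have "?E \<in> C m n"
    by (rule C_subalgebra[OF n D _ _ D_bounds]) (auto simp: carrier_D)
  then obtain k where k: "k \<le> n" "?E \<in> factor_var m n k"
    using two_element_factor_var[OF m n, of ?E bot top] by auto
  have "k = 0"
  proof (rule ccontr)
    assume "k \<noteq> 0"
    then have "compatible (C_type m n) ?E {(bot, top), (top, bot)}"
      using k by (intro proj_var_compatible[of _ _ _ k]) (auto simp: factor_var_def)
    then show False using D_swap by (simp add: compatible_def)
  qed
  then show ?thesis using k(2) by (simp add: factor_var_def)
qed

text \<open>With base point \<open>bot\<close>, monotonicity puts \<open>\<pi> k y\<close> below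
  \<open>\<pi> k top\<close>. For \<open>k \<noteq> 0\<close> the latter is computed among the
  bounds, where \<open>dd\<close> returns entry 0, that is \<open>bot\<close>. So these projections
  are constant, and \<open>\<pi> 0\<close> alone separates points.\<close>

lemma D_RLat: "D \<in> RLat_ext m n"
proof -
  interpret C_member m n D bot using m n D carrier_D by unfold_locales auto
  have bot: "\<pi> k y = bot" if k: "k \<le> n" "k \<noteq> 0" and y: "y \<in> L" for k y
  proof -
    let ?xs = "(replicate (Suc n) bot)[k := y]" and ?ys = "(replicate (Suc n) bot)[k := top]"
    let ?E = "D\<lparr>carrier := {bot, top}\<rparr>"
    have "(dd n D ?xs, dd n D ?ys) \<in> le"
    proof (rule dd_compatible[OF D_le])
      fix l assume "l \<le> n"
      then show "(?xs ! l, ?ys ! l) \<in> le"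
        using y by (cases "l = k") (simp_all add: le_def del: replicate_Suc)
    qed (simp_all del: replicate_Suc)
    moreover have "dd n D ?ys = dd n ?E ?ys" by (simp add: dd_def)
    moreover have "dd n ?E ?ys = ?ys ! 0"
      using bounds_RLat set_update_subset_insert[of "replicate (Suc n) bot" k top]
      by (intro dd_factor[of _ m]) (auto simp: factor_var_def simp del: replicate_Suc)
    moreover have "?ys ! 0 = bot" using k by (simp del: replicate_Suc)
    ultimately show ?thesis using bt by (auto simp: le_def prj_def)
  qed
  have "inj_on (\<pi> 0) (carrier D)"
  proof (rule inj_onI)
    fix x y assume xy: "x \<in> carrier D" "y \<in> carrier D" "\<pi> 0 x = \<pi> 0 y"
    show "x = y"
    proof (rule prj_inj[OF xy(1,2)])
      fix k assume "k \<le> n"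
      then show "\<pi> k x = \<pi> k y" using bot[of k] xy by (cases "k = 0") (auto simp: carrier_D)
    qed
  qed
  then have "D \<in> factor_var m n 0" by (intro factor_var_if_prj_inj) auto
  then show ?thesis by (simp add: factor_var_def)
qed

abbreviation J :: "'a \<Rightarrow> 'a \<Rightarrow> 'a" where "J x y \<equiv> opn D Join [x, y]"
abbreviation M :: "'a \<Rightarrow> 'a \<Rightarrow> 'a" where "M x y \<equiv> opn D Meet [x, y]"
abbreviation g' :: "'a \<Rightarrow> 'a" where "g' x \<equiv> opn D (G m) [x]"

lemmas D_closed = RLat_extD(1-3)[OF D_RLat, unfolded carrier_D]

lemma g_J: "x \<in> L \<Longrightarrow> y \<in> L \<Longrightarrow> g (J x y) = J (g x) (g y)"
  using compatible_binary[OF D_graph, of Join x "g x" y "g y"] by auto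

lemma g_g': "x \<in> L \<Longrightarrow> g (g' x) = g' (g x)"
  using compatible_unary[OF D_graph, of "G m" x "g x"] by auto

lemma JJ: "x \<in> L \<Longrightarrow> J x x = x"
  using RLat_extD(8)[OF D_RLat, of x "J x x"] RLat_extD(9)[OF D_RLat, of x x] D_closed by (simp add: carrier_D)

lemma J_trans:
  assumes "x \<in> L" "y \<in> L" "z \<in> L" "J x y = y" "J y z = z"
  shows "J x z = z"
  using RLat_extD(6)[OF D_RLat, of x y z] assms by (simp add: carrier_D)

text \<open>Atoms are conjugate under the automorphism, which has finite order: a comparability
  \<open>x \<le> z\<close> could be iterated to an ascending cycle.\<close>

lemma atoms_incomparable:
  assumes le: "J (at a) (at b) = at b"
  shows "at a = at b"
proof -
  \<comment> \<open>Plays the role of \<open>b - a\<close> modulo \<open>i\<close> without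
    subtraction: a shift by \<open>t\<close> takes the atom of index \<open>a\<close> to that of
    index \<open>b\<close>.\<close>
  define t where "t = b + (i - 1) * a"
  have "a + t = b + i * a" using i by (cases i) (simp_all add: t_def)
  then have ab: "at (a + t) = at b" by (simp add: at_eq)
  have step: "J (at (a + r * t)) (at (a + Suc r * t)) = at (a + Suc r * t)" for r
  proof (induction r)
    case 0
    then show ?case using le ab by simp
  next
    case (Suc r)
    have pow: "(g ^^ s) (J (at u) (at v)) = J (at (u + s)) (at (v + s))" for s u v
    proof (induction s)
      case (Suc s)
      then show ?case by (simp add: g_J g_at)
    qed simp
    show ?case using arg_cong[OF Suc, of "g ^^ t"] by (simp add: pow g_pow_at ac_simps)
  qed
  have "J (at b) (at (a + Suc r * t)) = at (a + Suc r * t)" for r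
  proof (induction r)
    case 0
    then show ?case using JJ[of "at b"] ab by simp
  next
    case (Suc r)
    show ?case by (rule J_trans[OF _ _ _ Suc step]) auto
  qed
  \<comment> \<open>After \<open>i\<close> shifts by \<open>t\<close> the index is back at
    \<open>a\<close> modulo \<open>i\<close>, which gives the reverse comparison.\<close>
  from this[of "i - 1"] have "J (at b) (at (a + i * t)) = at (a + i * t)" using i by simp
  moreover have "at (a + i * t) = at a" by (simp add: at_eq)
  ultimately show ?thesis using le RLat_extD(4)[OF D_RLat, of "at a" "at b"] by (simp add: carrier_D)
qed

lemma J_self:
  assumes "x \<in> L" "y \<in> L"
  shows "J x (J x y) = J x y" "J y (J x y) = J x y" "J (M x y) x = x" "J (M x y) y = y"
proof -
  have 1: "J x (J x y) = J x y" if "x \<in> L" "y \<in> L" for x y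
    using RLat_extD(6)[OF D_RLat, of x x y] JJ that by (simp add: carrier_D)
  show "J x (J x y) = J x y" by (rule 1[OF assms])
  show "J y (J x y) = J x y"
    using 1[of y x] RLat_extD(4)[OF D_RLat, of x y] assms by (simp add: carrier_D)
  have 2: "J (M x y) x = x" if "x \<in> L" "y \<in> L" for x y
    using RLat_extD(8)[OF D_RLat, of x y] RLat_extD(4)[OF D_RLat, of x "M x y"] that D_closed
    by (simp add: carrier_D)
  show "J (M x y) x = x" "J (M x y) y = y"
    using 2[of x y] 2[of y x] RLat_extD(5)[OF D_RLat, of x y] assms by (simp_all add: carrier_D)
qed

lemma bounds_closed: "x \<in> {bot, top} \<Longrightarrow> y \<in> {bot, top} \<Longrightarrow> J x y \<in> {bot, top} \<and> M x y \<in> {bot, top}"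
  using RLat_extD(1,2)[OF bounds_RLat, of x y] by simp

text \<open>If the join were another atom, it would be comparable to \<open>x\<close> and to
  \<open>y\<close>, so neither of these could be an atom; but joins of bounds are bounds. Both
  bounds are allowed as values because the order of \<open>D\<close> may be upside down.\<close>

lemma J_mem:
  assumes "x \<in> L" "y \<in> L"
  shows "J x y \<in> {x, y, bot, top}"
proof (rule ccontr)
  assume *: "J x y \<notin> {x, y, bot, top}"
  then obtain c where c: "J x y = at c" using L_cases[OF D_closed(1)[OF assms]] by auto
  have "x \<in> {bot, top}"
    using L_cases[OF assms(1)] atoms_incomparable[of _ c] J_self(1)[OF assms] * c by fastforce
  moreover have "y \<in> {bot, top}"
    using L_cases[OF assms(2)] atoms_incomparable[of _ c] J_self(2)[OF assms] * c by fastforce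
  ultimately show False using bounds_closed * by blast
qed

lemma M_mem:
  assumes "x \<in> L" "y \<in> L"
  shows "M x y \<in> {x, y, bot, top}"
proof (rule ccontr)
  assume *: "M x y \<notin> {x, y, bot, top}"
  then obtain c where c: "M x y = at c" using L_cases[OF D_closed(2)[OF assms]] by auto
  have "x \<in> {bot, top}"
    using L_cases[OF assms(1)] atoms_incomparable[of c] J_self(3)[OF assms] * c by fastforce
  moreover have "y \<in> {bot, top}"
    using L_cases[OF assms(2)] atoms_incomparable[of c] J_self(4)[OF assms] * c by fastforce
  ultimately show False using bounds_closed * by blast
qed

text \<open>\<open>J_mem\<close> and \<open>M_mem\<close> keep joins and meets among the arguments
  and the bounds, so only \<open>g'\<close> demands more elements, and it maps bounds to bounds by
  \<open>bounds_RLat\<close>.\<close>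

lemma orbit_compatible:
  "compatible (C_type m n) D (Id_on ({bot, top} \<union> range (\<lambda>s. (g' ^^ s) (at 0))))"
proof -
  define Y where "Y = {bot, top} \<union> range (\<lambda>s. (g' ^^ s) (at 0))"
  have pow: "(g' ^^ s) (at 0) \<in> L" for s by (induction s) (auto simp: D_closed)
  then have Y: "x \<in> L" if "x \<in> Y" for x using that by (auto simp: Y_def)
  have bnd: "bot \<in> Y" "top \<in> Y" by (simp_all add: Y_def)
  have g'_Y: "g' x \<in> Y" if x: "x \<in> Y" for x
  proof (cases "x \<in> {bot, top}")
    case True
    then have "g' x \<in> {bot, top}" using RLat_extD(3)[OF bounds_RLat, of x] by simp
    then show ?thesis unfolding Y_def by (rule UnI1)
  next
    case False
    then obtain s where "x = (g' ^^ s) (at 0)" using x by (auto simp: Y_def)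
    then have "g' x = (g' ^^ Suc s) (at 0)" by simp
    then show ?thesis unfolding Y_def by (intro UnI2) (rule range_eqI)
  qed
  have "J x y \<in> Y" "M x y \<in> Y" if "x \<in> Y" "y \<in> Y" for x y
    using J_mem[OF Y Y, OF that] M_mem[OF Y Y, OF that] that bnd by auto
  then have "compatible (C_type m n) D (Id_on Y)"
    using Y g'_Y by (intro RLat_compatibleI[OF D_RLat n]) (auto simp: carrier_D)
  then show ?thesis by (simp add: Y_def)
qed

text \<open>On \<open>at 0\<close> the power \<open>s\<close> of \<open>g'\<close> agrees with
  \<open>g\<close>. As the two commute, the power \<open>s * m\<close> takes \<open>at 0\<close> to
  \<open>at m\<close>; but \<open>g'\<close> has period \<open>m\<close>, so
  \<open>at m = at 0\<close>.\<close>

lemma dvd_if_atom_in_orbit: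
  assumes "(g' ^^ s) (at 0) = at 1"
  shows "i dvd m"
proof -
  have pL: "(g' ^^ u) (at 0) \<in> L" for u by (induction u) (auto simp: D_closed)
  have comm: "(g' ^^ u) (g x) = g ((g' ^^ u) x) \<and> (g' ^^ u) x \<in> L" if "x \<in> L" for u x
    using that by (induction u) (auto simp: g_g' D_closed)
  have "(g' ^^ (s * r)) (at 0) = at r" for r
  proof (induction r)
    case (Suc r)
    have "(g' ^^ (s * Suc r)) (at 0) = (g' ^^ (s * r)) ((g' ^^ s) (at 0))"
      by (simp add: add.commute[of s] funpow_add)
    also have "\<dots> = (g' ^^ (s * r)) (g (at 0))" by (simp add: assms g_at)
    also have "\<dots> = at (Suc r)" using comm[of "at 0" "s * r"] Suc by (simp add: g_at)
    finally show ?case .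
  qed simp
  then have "(g' ^^ (m * s)) (at 0) = at m" by (simp add: mult.commute)
  moreover have "(g' ^^ (m * s)) (at 0) = at 0"
  proof (induction s)
    case (Suc s)
    then show ?case using RLat_extD(12)[OF D_RLat, of "at 0"] by (simp add: funpow_add carrier_D)
  qed simp
  ultimately show ?thesis by (simp add: at_eq mod_eq_0_iff_dvd)
qed

end

section \<open>Realising a diamond and comparing the automorphisms\<close>

lemma diamond_exists:
  assumes inf: "infinite (UNIV :: 'a set)" and i: "1 \<le> i"
  shows "\<exists>(at :: nat \<Rightarrow> 'a) bot top g. diamond at bot top g i"
proof -
  obtain e :: "nat \<Rightarrow> 'a" where e: "inj e" using infinite_countable_subset[OF inf] by blast
  define at where "at a = e (2 + a mod i)" for a
  \<comment> \<open>The chosen index is determined only modulo \<open>i\<close>, which suffices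
    because passing to the successor respects residues.\<close>
  define g where "g x = (if x \<in> range at then at (Suc (SOME a. x = at a)) else x)" for x
  have at: "at a = at b \<longleftrightarrow> a mod i = b mod i" for a b
    using e by (simp add: at_def inj_eq)
  have ne: "at a \<noteq> e 0" "at a \<noteq> e 1" for a using e by (auto simp: at_def inj_eq)
  have "g (at a) = at (Suc a)" for a
  proof -
    have "at a = at (SOME b. at a = at b)" by (rule someI[of _ a]) simp
    then have "a mod i = (SOME b. at a = at b) mod i" by (simp only: at)
    then have "Suc a mod i = Suc (SOME b. at a = at b) mod i" by (metis mod_Suc_eq)
    then show ?thesis by (simp add: g_def at)
  qed
  moreover have "g (e 0) = e 0" "g (e 1) = e 1" using ne by (auto simp: g_def) (metis ne)+
  ultimately have "diamond at (e 0) (e 1) g i"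
    using i at ne inj_eq[OF e, of 0 1] by unfold_locales simp_all
  then show ?thesis by blast
qed

lemma term_equivalent_dvd:
  assumes m: "1 \<le> m" and n: "1 \<le> n" and i: "1 \<le> i" and j: "1 \<le> j" and inf: "infinite (UNIV :: 'a set)"
    and te: "term_equivalent (C_type m n) (C m n :: (symb, 'a) alg set) (C_type i j) (C i j)"
  shows "i dvd m"
proof -
  obtain p q where p: "translation (C_type m n) (C_type i j) p" and q: "translation (C_type i j) (C_type m n) q"
    and pC: "\<And>B :: (symb, 'a) alg. B \<in> C i j \<Longrightarrow> derived_alg p B \<in> C m n"
    and pq: "\<And>B :: (symb, 'a) alg. B \<in> C i j \<Longrightarrow> same_alg (C_type i j) (derived_alg q (derived_alg p B)) B"
    using te unfolding term_equivalent_def by blast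
  obtain at :: "nat \<Rightarrow> 'a" and bot top g where "diamond at bot top g i"
    using diamond_exists[OF inf i] by blast
  then interpret diamond at bot top g i .
  let ?D = "derived_alg p diamond_alg"
  have B: "diamond_alg \<in> C i j"
    using diamond_RLat[OF j] by (intro factor_var_C[OF j, of 0]) (simp_all add: factor_var_def)
  \<comment> \<open>The translation \<open>q\<close> recovers the diamond from \<open>?D\<close>, so
    relations compatible with \<open>?D\<close> are compatible with the diamond.\<close>
  have pull_back: "compatible (C_type i j) diamond_alg R" if "R \<subseteq> L \<times> L" "compatible (C_type m n) ?D R" for R
    by (rule compatible_same[OF pq[OF B] _ derived_compatible[OF q that(2)]]) (simp add: that(1))
  interpret derived_diamond at bot top g i m n ?D
  proof
    show "\<not> compatible (C_type m n) ?D {(bot, top), (top, bot)}"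
      using pull_back[of "{(bot, top), (top, bot)}"] RLat_not_swap_compatible[OF diamond_RLat[OF j], of bot top] bt by auto
  qed (use m n pC[OF B] derived_compatible[OF p diamond_le[OF j]] derived_compatible[OF p diamond_graph[OF j]]
      derived_compatible[OF p diamond_bounds[OF j]] in simp_all)
  let ?Y = "{bot, top} \<union> range (\<lambda>s. (g' ^^ s) (at 0))"
  have "(g' ^^ s) (at 0) \<in> L" for s by (induction s) (auto simp: D_closed simp del: opn_derived)
  then have compat: "compatible (C_type i j) diamond_alg (Id_on ?Y)"
    by (intro pull_back[OF _ orbit_compatible]) auto
  have "at 0 \<in> ?Y" by (intro UnI2 range_eqI[of _ _ 0]) simp
  then have "(opn diamond_alg (G i) [at 0], opn diamond_alg (G i) [at 0]) \<in> Id_on ?Y"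
    by (intro compatible_unary[OF compat] Id_onI) simp
  \<comment> \<open>The orbit of \<open>g'\<close> with the bounds is closed under the diamond's own
    automorphism, which moves \<open>at 0\<close> to \<open>at 1\<close>.\<close>
  then have "at 1 \<in> ?Y" unfolding Id_on_iff by (simp only: diamond_simps g_at One_nat_def)
  then obtain s where "(g' ^^ s) (at 0) = at 1" using at_ne by (auto simp del: opn_derived)
  then show ?thesis by (rule dvd_if_atom_in_orbit)
qed

lemma term_equivalent_sym: "term_equivalent \<tau> V \<tau>' W \<Longrightarrow> term_equivalent \<tau>' W \<tau> V"
  unfolding term_equivalent_def by blast

theorem mainTheorem5:
  assumes "infinite (UNIV :: 'a set)"
  shows "(\<forall>m n. 1 \<le> m \<and> 1 \<le> n \<longrightarrow>
            strongly_tolerance_factorable (C_type m n)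
              (C m n :: (symb, 'a) alg set) (C m n :: (symb, 'a set) alg set) \<and>
            has_proper_tolerances (C_type m n) (C m n :: (symb, 'a) alg set))
       \<and> (\<forall>i j m n. 1 \<le> i \<and> 1 \<le> j \<and> 1 \<le> m \<and> 1 \<le> n \<longrightarrow>
            (term_equivalent (C_type m n) (C m n :: (symb, 'a) alg set)
                             (C_type i j) (C i j :: (symb, 'a) alg set)
             \<longleftrightarrow> (i, j) = (m, n)))"
proof (intro conjI allI impI; (elim conjE)?)
  fix m n :: nat assume mn: "1 \<le> m" "1 \<le> n"
  show "strongly_tolerance_factorable (C_type m n)
      (C m n :: (symb, 'a) alg set) (C m n :: (symb, 'a set) alg set)"
    by (rule C_strongly_tolerance_factorable[OF mn])
  show "has_proper_tolerances (C_type m n) (C m n :: (symb, 'a) alg set)"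
    by (rule C_has_proper_tolerances[OF assms mn(2)])
next
  fix i j m n :: nat assume *: "1 \<le> i" "1 \<le> j" "1 \<le> m" "1 \<le> n"
  show "term_equivalent (C_type m n) (C m n :: (symb, 'a) alg set) (C_type i j) (C i j) \<longleftrightarrow> (i, j) = (m, n)"
  proof
    assume te: "term_equivalent (C_type m n) (C m n :: (symb, 'a) alg set) (C_type i j) (C i j)"
    note te' = term_equivalent_sym[OF te]
    have "j = n"
      using term_equivalent_le[OF *(3,4,2) assms te] term_equivalent_le[OF *(1,2,4) assms te'] by simp
    moreover have "i = m"
      using term_equivalent_dvd[OF *(3,4,1,2) assms te] term_equivalent_dvd[OF *(1,2,3,4) assms te']
      by (rule dvd_antisym)
    ultimately show "(i, j) = (m, n)" by simp
  qed (use term_equivalent_refl[OF *(4)] in auto)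
qed

end
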